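(* The compact quantum semigroup $(C^*_{red}(S),\Delta)$ contains a dense weak Hopf algebra $(\mathbb{C}[\Sigma],\Delta,{}^* )$, where $\Sigma$ is the inverse semigroup of monomials generated by the operators $T_a,T_b^*$ ($a,b\in S$), the comultiplication is $\Delta(V)=V\otimes V$ for $V\in\Sigma$, and the weak antipode is the linear extension of $V\mapsto V^*$, $V\in\Sigma$.
   Context: $\Gamma$ is a discrete torsion-free abelian group written additively, and $S\subseteq\Gamma$ is a subsemigroup with $0\in S$ and $\Gamma=\{a-b : a,b\in S\}$. $\{e_a\}_{a\in S}$ is the canonical orthonormal basis of $\ell^2(S)$, and $T_a$ ($a\in S$) is the isometry $T_ae_b=e_{a+b}$. $C^*_{red}(S)\subseteq B(\ell^2(S))$ is the $C^*$-algebra generated by all $T_a,T_a^*$, $a\in S$. A monomial is a finite product of operators of the form $T_a$ and $T_b^*$ ($a,b\in S$). The monomials form an inverse semigroup $\Sigma$ in which the inverse of $V$ is $V^*$. $\Delta\colon C^*_{red}(S)\to C^*_{red}(S)\otimes C^*_{red}(S)$ (minimal tensor product) is the continuous extension of the map $\sum_i\lambda_iV_i\mapsto\sum_i\lambda_iV_i\otimes V_i$ on finite linear combinations of monomials. For an inverse semigroup $M$, $\mathbb{C}[M]$ is its semigroup algebra, with comultiplication $\Delta(\sum_i\lambda_ix_i)=\sum_i\lambda_ix_i\otimes x_i$ and the linear map $T$ determined by $T(x)=x^*$ for $x\in M$ ($x^*$ the inverse of $x$ in $M$). Weak Hopf algebra (in the sense of F. Li, no counit required): an algebra $A$ with a comultiplication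 $\Delta$ for which there is a linear map $T\colon A\to A$ (weak antipode) with $m(\mathrm{id}\otimes T\otimes\mathrm{id})(\Delta\otimes\mathrm{id})\Delta=\mathrm{id}$ and $m(T\otimes\mathrm{id}\otimes T)(\Delta\otimes\mathrm{id})\Delta=T$, where $m(a\otimes b\otimes c)=abc$. *)

theory Defs
  imports "HOL-Analysis.Analysis" "HOL-Library.Poly_Mapping"
begin

typedef 'i ell2 = "{f :: 'i \<Rightarrow> complex. (\<lambda>x. (cmod (f x))\<^sup>2) summable_on UNIV}"
  morphisms coord Abs_ell2
  by (rule exI[of _ "\<lambda>_. 0"]) simp

setup_lifting type_definition_ell2

lemma coord_summable: "(\<lambda>x. (cmod (coord f x))\<^sup>2) summable_on UNIV"
  using coord[of f] by simp

lemma summable_sq_add: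
  fixes f g :: "'i \<Rightarrow> complex"
  assumes "(\<lambda>x. (cmod (f x))\<^sup>2) summable_on UNIV" "(\<lambda>x. (cmod (g x))\<^sup>2) summable_on UNIV"
  shows "(\<lambda>x. (cmod (f x + g x))\<^sup>2) summable_on UNIV"
proof (rule summable_on_comparison_test)
  show "(\<lambda>x. 2 * (cmod (f x))\<^sup>2 + 2 * (cmod (g x))\<^sup>2) summable_on UNIV"
    by (intro summable_on_add summable_on_cmult_right assms)
  fix x
  have "(cmod (f x + g x))\<^sup>2 \<le> (cmod (f x) + cmod (g x))\<^sup>2"
    by (intro power_mono norm_triangle_ineq norm_ge_zero)
  also have "\<dots> \<le> 2 * (cmod (f x))\<^sup>2 + 2 * (cmod (g x))\<^sup>2"
    using sum_squares_bound[of "cmod (f x)" "cmod (g x)"] by (simp add: power2_sum)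
  finally show "(cmod (f x + g x))\<^sup>2 \<le> 2 * (cmod (f x))\<^sup>2 + 2 * (cmod (g x))\<^sup>2" .
qed simp

lemma summable_sq_scale:
  fixes f :: "'i \<Rightarrow> complex"
  assumes "(\<lambda>x. (cmod (f x))\<^sup>2) summable_on UNIV"
  shows "(\<lambda>x. (cmod (c * f x))\<^sup>2) summable_on UNIV"
  by (simp add: norm_mult power_mult_distrib summable_on_cmult_right assms)

lemma summable_Re_cnj_mult:
  fixes f g :: "'i \<Rightarrow> complex"
  assumes "(\<lambda>x. (cmod (f x))\<^sup>2) summable_on UNIV" "(\<lambda>x. (cmod (g x))\<^sup>2) summable_on UNIV"
  shows "(\<lambda>x. cnj (f x) * g x) summable_on UNIV"
    and "(\<lambda>x. Re (cnj (f x) * g x)) summable_on UNIV"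
proof -
  have "(\<lambda>x. norm (cnj (f x) * g x)) summable_on UNIV"
  proof (rule abs_summable_product)
    show "(\<lambda>x. norm (cnj (f x) * cnj (f x))) summable_on UNIV"
      using assms(1) by (simp add: norm_mult power2_eq_square)
    show "(\<lambda>x. norm (g x * g x)) summable_on UNIV"
      using assms(2) by (simp add: norm_mult power2_eq_square)
  qed
  then show s: "(\<lambda>x. cnj (f x) * g x) summable_on UNIV"
    by (rule abs_summable_summable)
  show "(\<lambda>x. Re (cnj (f x) * g x)) summable_on UNIV"
    using summable_on_Re[OF s] .
qed

instantiation ell2 :: (type) real_inner
begin

lift_definition zero_ell2 :: "'a ell2" is "\<lambda>_. 0" by simp
lift_definition plus_ell2 :: "'a ell2 \<Rightarrow> 'a ell2 \<Rightarrow> 'a ell2" is "\<lambda>f g x. f x + g x"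
  by (rule summable_sq_add)
lift_definition uminus_ell2 :: "'a ell2 \<Rightarrow> 'a ell2" is "\<lambda>f x. - f x" by simp
definition minus_ell2 :: "'a ell2 \<Rightarrow> 'a ell2 \<Rightarrow> 'a ell2" where "minus_ell2 f g = f + - g"
lift_definition scaleR_ell2 :: "real \<Rightarrow> 'a ell2 \<Rightarrow> 'a ell2" is "\<lambda>r f x. complex_of_real r * f x"
  by (rule summable_sq_scale)
lift_definition inner_ell2 :: "'a ell2 \<Rightarrow> 'a ell2 \<Rightarrow> real"
  is "\<lambda>f g. \<Sum>\<^sub>\<infinity>x. Re (cnj (f x) * g x)" .
definition norm_ell2 :: "'a ell2 \<Rightarrow> real" where "norm_ell2 f = sqrt (inner f f)"
definition dist_ell2 :: "'a ell2 \<Rightarrow> 'a ell2 \<Rightarrow> real" where "dist_ell2 f g = norm (f - g)"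
definition sgn_ell2 :: "'a ell2 \<Rightarrow> 'a ell2" where "sgn_ell2 f = scaleR (inverse (norm f)) f"
definition uniformity_ell2 :: "('a ell2 \<times> 'a ell2) filter" where
  "uniformity_ell2 = (INF e\<in>{0<..}. principal {(x, y). dist (x :: 'a ell2) y < e})"
definition open_ell2 :: "'a ell2 set \<Rightarrow> bool" where
  "open_ell2 U \<longleftrightarrow> (\<forall>x\<in>U. \<forall>\<^sub>F (x', y) in uniformity. x' = x \<longrightarrow> y \<in> U)"

instance
proof
  fix f g h :: "'a ell2" and r s :: real and U :: "'a ell2 set"
  show "f + g + h = f + (g + h)" by transfer (simp add: add.assoc)
  show "f + g = g + f" by transfer (simp add: add.commute)
  show "0 + f = f" by transfer simp
  show "- f + f = 0" by transfer simp
  show "f - g = f + - g" by (simp add: minus_ell2_def)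
  show "r *\<^sub>R (f + g) = r *\<^sub>R f + r *\<^sub>R g" by transfer (simp add: distrib_left)
  show "(r + s) *\<^sub>R f = r *\<^sub>R f + s *\<^sub>R f" by transfer (simp add: distrib_right)
  show "r *\<^sub>R s *\<^sub>R f = (r * s) *\<^sub>R f" by transfer (simp add: mult.assoc)
  show "1 *\<^sub>R f = f" by transfer simp
  show "sgn f = inverse (norm f) *\<^sub>R f" by (rule sgn_ell2_def)
  show "dist f g = norm (f - g)" by (rule dist_ell2_def)
  show "(uniformity :: ('a ell2 \<times> 'a ell2) filter) = (INF e\<in>{0<..}. principal {(x, y). dist x y < e})"
    by (rule uniformity_ell2_def)
  show "open U = (\<forall>x\<in>U. \<forall>\<^sub>F (x', y) in uniformity. x' = x \<longrightarrow> y \<in> U)"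
    by (rule open_ell2_def)
  show "inner f g = inner g f"
    by transfer (simp add: algebra_simps)
  have "(\<Sum>\<^sub>\<infinity>x. Re (cnj (coord f x + coord g x) * coord h x))
      = (\<Sum>\<^sub>\<infinity>x. Re (cnj (coord f x) * coord h x) + Re (cnj (coord g x) * coord h x))"
    by (rule infsum_cong) (simp add: algebra_simps)
  also have "\<dots> = (\<Sum>\<^sub>\<infinity>x. Re (cnj (coord f x) * coord h x))
      + (\<Sum>\<^sub>\<infinity>x. Re (cnj (coord g x) * coord h x))"
    by (intro infsum_add summable_Re_cnj_mult coord_summable)
  finally show "inner (f + g) h = inner f h + inner g h"
    by (simp add: inner_ell2.rep_eq plus_ell2.rep_eq)
  have "(\<Sum>\<^sub>\<infinity>x. Re (cnj (complex_of_real r * coord f x) * coord g x))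
      = (\<Sum>\<^sub>\<infinity>x. r * Re (cnj (coord f x) * coord g x))"
    by (rule infsum_cong) (simp add: algebra_simps)
  also have "\<dots> = r * (\<Sum>\<^sub>\<infinity>x. Re (cnj (coord f x) * coord g x))"
    by (rule infsum_cmult_right')
  finally show "inner (r *\<^sub>R f) g = r * inner f g"
    by (simp add: inner_ell2.rep_eq scaleR_ell2.rep_eq)
  have sq: "Re (cnj z * z) = (cmod z)\<^sup>2" for z
    unfolding cmod_power2 by (simp add: power2_eq_square)
  show "0 \<le> inner f f"
    by transfer (auto intro!: infsum_nonneg simp: sq simp del: complex_mult_cnj)
  show "inner f f = 0 \<longleftrightarrow> f = 0"
  proof
    assume "inner f f = 0"
    then have z: "(\<Sum>\<^sub>\<infinity>x. (cmod (coord f x))\<^sup>2) = 0"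
      by (simp only: inner_ell2.rep_eq sq)
    have "(cmod (coord f x))\<^sup>2 = 0" for x
      using nonneg_infsum_le_0D[of "\<lambda>x. (cmod (coord f x))\<^sup>2" UNIV x] z coord_summable[of f] by simp
    then show "f = 0" by (simp add: coord_inject[symmetric] zero_ell2.rep_eq fun_eq_iff)
  next
    assume "f = 0" then show "inner f f = 0" by (simp add: inner_ell2.rep_eq zero_ell2.rep_eq)
  qed
  show "norm f = sqrt (inner f f)" by (rule norm_ell2_def)
qed

end

lemma norm_ell2_eq: "norm f = sqrt (\<Sum>\<^sub>\<infinity>x. (cmod (coord f x))\<^sup>2)"
proof -
  have "Re (cnj z * z) = (cmod z)\<^sup>2" for z
    unfolding cmod_power2 by (simp add: power2_eq_square)
  then show ?thesis by (simp add: norm_eq_sqrt_inner inner_ell2.rep_eq)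
qed

lift_definition cinner :: "'i ell2 \<Rightarrow> 'i ell2 \<Rightarrow> complex"
  is "\<lambda>f g. \<Sum>\<^sub>\<infinity>x. cnj (f x) * g x" .

lift_definition cscale :: "complex \<Rightarrow> 'i ell2 \<Rightarrow> 'i ell2" is "\<lambda>c f x. c * f x"
  by (rule summable_sq_scale)

lemma summable_sq_delta: "(\<lambda>x. (cmod (if x = a then 1 else 0))\<^sup>2) summable_on UNIV"
  by (rule summable_on_cong_neutral[THEN iffD1, of UNIV "{a}" _ "\<lambda>_. 1"]) auto

lift_definition ket :: "'i \<Rightarrow> 'i ell2" is "\<lambda>a x. if x = a then 1 else 0"
  by (rule summable_sq_delta)

lemma summable_sq_tensor:
  fixes f :: "'i \<Rightarrow> complex" and g :: "'j \<Rightarrow> complex"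
  assumes f: "(\<lambda>x. (cmod (f x))\<^sup>2) summable_on UNIV" and g: "(\<lambda>x. (cmod (g x))\<^sup>2) summable_on UNIV"
  shows "(\<lambda>xy. (cmod (case xy of (x, y) \<Rightarrow> f x * g y))\<^sup>2) summable_on UNIV"
proof -
  have "(\<lambda>(x, y). (cmod (f x))\<^sup>2 * (cmod (g y))\<^sup>2) summable_on UNIV \<times> UNIV"
  proof (rule summable_on_SigmaI)
    show "((\<lambda>y. case (x, y) of (x, y) \<Rightarrow> (cmod (f x))\<^sup>2 * (cmod (g y))\<^sup>2)
        has_sum ((cmod (f x))\<^sup>2 * (\<Sum>\<^sub>\<infinity>y. (cmod (g y))\<^sup>2))) UNIV" for x
      unfolding prod.case by (intro has_sum_cmult_right has_sum_infsum g)
    show "(\<lambda>x. (cmod (f x))\<^sup>2 * (\<Sum>\<^sub>\<infinity>y. (cmod (g y))\<^sup>2)) summable_on UNIV"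
      by (intro summable_on_cmult_left f)
  qed simp
  then show ?thesis
    by (simp add: case_prod_unfold norm_mult power_mult_distrib)
qed

lift_definition vec_tensor :: "'i ell2 \<Rightarrow> 'j ell2 \<Rightarrow> ('i \<times> 'j) ell2"
  is "\<lambda>f g (x, y). f x * g y"
  by (rule summable_sq_tensor)

text \<open>
  Operators are real-linear bounded maps carrying the operator norm; complex linearity is
  demanded in the algebras below.  For \<open>X\<close> a subset of the index type, \<open>\<ell>\<^sup>2(X)\<close> is the subspace
  of families vanishing off \<open>X\<close>, and an operator on it is extended by zero to its orthogonal
  complement.  So \<open>B(\<ell>\<^sup>2(X))\<close> is the corner \<open>bounded_ops X\<close>, with unit \<open>proj X\<close>.
\<close>

type_synonym 'i op = "'i ell2 \<Rightarrow>\<^sub>L 'i ell2"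

lemma ell2_contraction:
  fixes F :: "'i ell2 \<Rightarrow> 'j ell2"
  assumes "\<And>f g. F (f + g) = F f + F g" "\<And>r f. F (r *\<^sub>R f) = r *\<^sub>R F f"
    and "\<And>f. (\<Sum>\<^sub>\<infinity>x. (cmod (coord (F f) x))\<^sup>2) \<le> K\<^sup>2 * (\<Sum>\<^sub>\<infinity>x. (cmod (coord f x))\<^sup>2)" and "K \<ge> 0"
  shows "bounded_linear F"
proof (rule bounded_linear_intro)
  fix f
  have "norm (F f) \<le> sqrt (K\<^sup>2 * (\<Sum>\<^sub>\<infinity>x. (cmod (coord f x))\<^sup>2))"
    unfolding norm_ell2_eq by (rule real_sqrt_le_mono[OF assms(3)])
  also have "\<dots> = norm f * K"
    using assms(4) by (simp add: norm_ell2_eq real_sqrt_mult)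
  finally show "norm (F f) \<le> norm f * K" .
qed (use assms in auto)

lemma summable_sq_reindex:
  fixes f :: "'j \<Rightarrow> complex" and h :: "'i \<Rightarrow> 'j"
  assumes "inj_on h X" "(\<lambda>x. (cmod (f x))\<^sup>2) summable_on UNIV"
  shows "(\<lambda>x. (cmod (if x \<in> X then f (h x) else 0))\<^sup>2) summable_on UNIV"
    and "(\<Sum>\<^sub>\<infinity>x. (cmod (if x \<in> X then f (h x) else 0))\<^sup>2) \<le> (\<Sum>\<^sub>\<infinity>x. (cmod (f x))\<^sup>2)"
proof -
  have sX: "(\<lambda>x. (cmod (f x))\<^sup>2) summable_on h ` X"
    using assms(2) summable_on_subset_banach by blast
  then have "((\<lambda>x. (cmod (f x))\<^sup>2) \<circ> h) summable_on X"
    using summable_on_reindex[OF assms(1)] by blast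
  then show "(\<lambda>x. (cmod (if x \<in> X then f (h x) else 0))\<^sup>2) summable_on UNIV"
    by (subst summable_on_cong_neutral[of X _ "(\<lambda>x. (cmod (f x))\<^sup>2) \<circ> h"]) auto
  have "(\<Sum>\<^sub>\<infinity>x. (cmod (if x \<in> X then f (h x) else 0))\<^sup>2) = infsum ((\<lambda>x. (cmod (f x))\<^sup>2) \<circ> h) X"
    by (rule infsum_cong_neutral) auto
  also have "\<dots> = (\<Sum>\<^sub>\<infinity>x\<in>h ` X. (cmod (f x))\<^sup>2)"
    by (rule infsum_reindex[OF assms(1), symmetric])
  also have "\<dots> \<le> (\<Sum>\<^sub>\<infinity>x. (cmod (f x))\<^sup>2)"
    by (rule infsum_mono_neutral[OF sX assms(2)]) auto
  finally show "(\<Sum>\<^sub>\<infinity>x. (cmod (if x \<in> X then f (h x) else 0))\<^sup>2) \<le> (\<Sum>\<^sub>\<infinity>x. (cmod (f x))\<^sup>2)" .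
qed

lift_definition restrict_vec :: "'i set \<Rightarrow> 'i ell2 \<Rightarrow> 'i ell2"
  is "\<lambda>X f x. if x \<in> X then f x else 0"
  by (rule summable_sq_reindex(1)[where h = "\<lambda>x. x"]) auto

lift_definition proj :: "'i set \<Rightarrow> 'i op" is restrict_vec
proof (rule ell2_contraction[where K = 1])
  fix X :: "'i set" and f :: "'i ell2"
  show "(\<Sum>\<^sub>\<infinity>x. (cmod (coord (restrict_vec X f) x))\<^sup>2) \<le> 1\<^sup>2 * (\<Sum>\<^sub>\<infinity>x. (cmod (coord f x))\<^sup>2)"
    using summable_sq_reindex(2)[where h = "\<lambda>x. x" and X = X, OF _ coord_summable[of f]]
    by (simp add: restrict_vec.rep_eq)
qed (transfer; auto)+

lift_definition scalar_op :: "complex \<Rightarrow> 'i op" is cscale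
proof -
  fix c
  show "bounded_linear (cscale c :: 'i ell2 \<Rightarrow> _)"
  proof (rule ell2_contraction[where K = "cmod c"])
    fix f :: "'i ell2"
    show "(\<Sum>\<^sub>\<infinity>x. (cmod (coord (cscale c f) x))\<^sup>2) \<le> (cmod c)\<^sup>2 * (\<Sum>\<^sub>\<infinity>x. (cmod (coord f x))\<^sup>2)"
      by (simp add: cscale.rep_eq norm_mult power_mult_distrib infsum_cmult_right')
  qed (transfer; auto simp: algebra_simps)+
qed

definition cmul :: "complex \<Rightarrow> 'i op \<Rightarrow> 'i op" where
  "cmul c T = scalar_op c o\<^sub>L T"

definition bounded_ops :: "'i set \<Rightarrow> 'i op set" where
  "bounded_ops X = {T. proj X o\<^sub>L T = T \<and> T o\<^sub>L proj X = T \<and>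
     (\<forall>c f. blinfun_apply T (cscale c f) = cscale c (blinfun_apply T f))}"

definition adj :: "'i op \<Rightarrow> 'i op" where
  "adj T = (THE R :: 'i op. \<forall>f g. cinner (T f) g = cinner f (R g))"

definition op_tensor :: "'i op \<Rightarrow> 'j op \<Rightarrow> ('i \<times> 'j) op" where
  "op_tensor T R = (THE U :: ('i \<times> 'j) op. \<forall>f g. U (vec_tensor f g) = vec_tensor (T f) (R g))"

definition cstar_subalgebra :: "'i set \<Rightarrow> 'i op set \<Rightarrow> bool" where
  "cstar_subalgebra X A \<longleftrightarrow>
     A \<subseteq> bounded_ops X \<and> 0 \<in> A \<and>
     (\<forall>T\<in>A. \<forall>R\<in>A. T + R \<in> A \<and> T o\<^sub>L R \<in> A) \<and>
     (\<forall>c. \<forall>T\<in>A. cmul c T \<in> A) \<and> (\<forall>T\<in>A. adj T \<in> A) \<and> closed A"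

definition clinear_map_on :: "'i op set \<Rightarrow> ('i op \<Rightarrow> 'j op) \<Rightarrow> bool" where
  "clinear_map_on A F \<longleftrightarrow>
     (\<forall>T\<in>A. \<forall>R\<in>A. F (T + R) = F T + F R) \<and> (\<forall>c. \<forall>T\<in>A. F (cmul c T) = cmul c (F T))"

definition star_hom :: "'i op set \<Rightarrow> 'j op set \<Rightarrow> ('i op \<Rightarrow> 'j op) \<Rightarrow> bool" where
  "star_hom A B F \<longleftrightarrow>
     F ` A \<subseteq> B \<and> clinear_map_on A F \<and>
     (\<forall>T\<in>A. \<forall>R\<in>A. F (T o\<^sub>L R) = F T o\<^sub>L F R) \<and> (\<forall>T\<in>A. F (adj T) = adj (F T))"

text \<open>
  The spatial tensor product.  For complex subspaces \<open>A\<close>, \<open>B\<close> the real span of the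
  elementary tensors is already their complex span.
\<close>

definition min_tensor :: "'i op set \<Rightarrow> 'j op set \<Rightarrow> ('i \<times> 'j) op set" where
  "min_tensor A B = closure (span {op_tensor T R | T R. T \<in> A \<and> R \<in> B})"

text \<open>\<open>F\<close> is the continuous extension of \<open>p \<otimes> q\<close> to the minimal tensor product.\<close>

definition is_tensor_map ::
  "'i op set \<Rightarrow> 'j op set \<Rightarrow> ('i op \<Rightarrow> 'k op) \<Rightarrow> ('j op \<Rightarrow> 'l op) \<Rightarrow>
     (('i \<times> 'j) op \<Rightarrow> ('k \<times> 'l) op) \<Rightarrow> bool" where
  "is_tensor_map A B p q F \<longleftrightarrow>
     continuous_on (min_tensor A B) F \<and> clinear_map_on (min_tensor A B) F \<and>
     (\<forall>T\<in>A. \<forall>R\<in>B. F (op_tensor T R) = op_tensor (p T) (q R))"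

text \<open>
  Coassociativity compares operators on \<open>\<ell>\<^sup>2((X \<times> X) \<times> X)\<close> and \<open>\<ell>\<^sup>2(X \<times> (X \<times> X))\<close>: they agree under
  the canonical identification of the two spaces iff all their matrix entries agree.
\<close>

definition compact_quantum_semigroup ::
  "'i set \<Rightarrow> 'i op set \<Rightarrow> ('i op \<Rightarrow> ('i \<times> 'i) op) \<Rightarrow> bool" where
  "compact_quantum_semigroup X A \<Delta> \<longleftrightarrow>
     cstar_subalgebra X A \<and> proj X \<in> A \<and>
     star_hom A (min_tensor A A) \<Delta> \<and> \<Delta> (proj X) = op_tensor (proj X) (proj X) \<and>
     (\<exists>F G. is_tensor_map A A \<Delta> (\<lambda>T. T) F \<and> is_tensor_map A A (\<lambda>T. T) \<Delta> G \<and>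
        (\<forall>T\<in>A. \<forall>a b c a' b' c'.
           coord (F (\<Delta> T) (ket ((a, b), c))) ((a', b'), c') =
           coord (G (\<Delta> T) (ket (a, (b, c)))) (a', (b', c'))))"

lift_definition shift_vec :: "'g::ab_group_add set \<Rightarrow> 'g \<Rightarrow> 'g ell2 \<Rightarrow> 'g ell2"
  is "\<lambda>S a f x. if x \<in> {x. x - a \<in> S} then f (x - a) else 0"
  by (rule summable_sq_reindex(1)) (auto simp: inj_on_def)

lift_definition shift :: "'g::ab_group_add set \<Rightarrow> 'g \<Rightarrow> 'g op" is shift_vec
proof (rule ell2_contraction[where K = 1])
  fix S and a :: 'g and f :: "'g ell2"
  show "(\<Sum>\<^sub>\<infinity>x. (cmod (coord (shift_vec S a f) x))\<^sup>2) \<le> 1\<^sup>2 * (\<Sum>\<^sub>\<infinity>x. (cmod (coord f x))\<^sup>2)"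
    using summable_sq_reindex(2)[where h = "\<lambda>x. x - a" and X = "{x. x - a \<in> S}", OF _ coord_summable[of f]]
    by (simp add: shift_vec.rep_eq inj_on_def)
qed (transfer; auto)+

lemma shift_ket: "shift S a (ket b) = (if b \<in> S then ket (a + b) else 0)"
  by (auto simp: shift.rep_eq shift_vec.rep_eq ket.rep_eq zero_ell2.rep_eq coord_inject[symmetric]
      fun_eq_iff algebra_simps)

definition reduced_cstar :: "'g::ab_group_add set \<Rightarrow> 'g op set" where
  "reduced_cstar S = cstar_subalgebra S hull (\<Union>a\<in>S. {shift S a, adj (shift S a)})"

inductive_set monomials :: "'g::ab_group_add set \<Rightarrow> 'g op set" for S where
  "a \<in> S \<Longrightarrow> shift S a \<in> monomials S"
| "a \<in> S \<Longrightarrow> adj (shift S a) \<in> monomials S"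
| "V \<in> monomials S \<Longrightarrow> W \<in> monomials S \<Longrightarrow> V o\<^sub>L W \<in> monomials S"

definition inverse_semigroup :: "'m set \<Rightarrow> ('m \<Rightarrow> 'm \<Rightarrow> 'm) \<Rightarrow> ('m \<Rightarrow> 'm) \<Rightarrow> bool" where
  "inverse_semigroup M mul star \<longleftrightarrow>
     (\<forall>x\<in>M. \<forall>y\<in>M. mul x y \<in> M) \<and>
     (\<forall>x\<in>M. \<forall>y\<in>M. \<forall>z\<in>M. mul (mul x y) z = mul x (mul y z)) \<and>
     (\<forall>x\<in>M. star x \<in> M \<and>
        (\<forall>y\<in>M. mul (mul x y) x = x \<and> mul (mul y x) y = y \<longleftrightarrow> y = star x))"

text \<open>
  The vector space \<open>\<complex>[M]\<close> with basis \<open>M\<close> consists of the finitely supported functions with support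
  in \<open>M\<close>.  The algebraic tensor product \<open>\<complex>[M] \<otimes> \<complex>[N]\<close> is \<open>\<complex>[M \<times> N]\<close>.
\<close>

definition free_space :: "'m set \<Rightarrow> ('m \<Rightarrow>\<^sub>0 complex) set" where
  "free_space M = {x. Poly_Mapping.keys x \<subseteq> M}"

definition smul :: "complex \<Rightarrow> ('m \<Rightarrow>\<^sub>0 complex) \<Rightarrow> ('m \<Rightarrow>\<^sub>0 complex)" where
  "smul c x = Poly_Mapping.map (\<lambda>d. c * d) x"

abbreviation basis :: "'m \<Rightarrow> ('m \<Rightarrow>\<^sub>0 complex)" where
  "basis u \<equiv> Poly_Mapping.single u 1"

definition lin_ext :: "('m \<Rightarrow> ('n \<Rightarrow>\<^sub>0 complex)) \<Rightarrow> ('m \<Rightarrow>\<^sub>0 complex) \<Rightarrow> ('n \<Rightarrow>\<^sub>0 complex)" where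
  "lin_ext p x = (\<Sum>u\<in>Poly_Mapping.keys x. smul (Poly_Mapping.lookup x u) (p u))"

definition linear_on_free ::
  "'m set \<Rightarrow> 'n set \<Rightarrow> (('m \<Rightarrow>\<^sub>0 complex) \<Rightarrow> ('n \<Rightarrow>\<^sub>0 complex)) \<Rightarrow> bool" where
  "linear_on_free M N p \<longleftrightarrow>
     (\<forall>x\<in>free_space M. p x \<in> free_space N) \<and>
     (\<forall>x\<in>free_space M. \<forall>y\<in>free_space M. p (x + y) = p x + p y) \<and>
     (\<forall>c. \<forall>x\<in>free_space M. p (smul c x) = smul c (p x))"

definition tensor :: "('m \<Rightarrow>\<^sub>0 complex) \<Rightarrow> ('n \<Rightarrow>\<^sub>0 complex) \<Rightarrow> ('m \<times> 'n \<Rightarrow>\<^sub>0 complex)" where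
  "tensor x y = lin_ext (\<lambda>u. lin_ext (\<lambda>v. basis (u, v)) y) x"

definition tensor_map ::
  "(('m \<Rightarrow>\<^sub>0 complex) \<Rightarrow> ('k \<Rightarrow>\<^sub>0 complex)) \<Rightarrow> (('n \<Rightarrow>\<^sub>0 complex) \<Rightarrow> ('l \<Rightarrow>\<^sub>0 complex)) \<Rightarrow>
     ('m \<times> 'n \<Rightarrow>\<^sub>0 complex) \<Rightarrow> ('k \<times> 'l \<Rightarrow>\<^sub>0 complex)" where
  "tensor_map p q = lin_ext (\<lambda>(u, v). tensor (p (basis u)) (q (basis v)))"

definition tensor_assoc :: "(('m \<times> 'n) \<times> 'k \<Rightarrow>\<^sub>0 complex) \<Rightarrow> ('m \<times> 'n \<times> 'k \<Rightarrow>\<^sub>0 complex)" where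
  "tensor_assoc = lin_ext (\<lambda>((u, v), w). basis (u, v, w))"

text \<open>\<open>tensor_mult\<close> is \<open>(a \<otimes> b) (c \<otimes> d) = ac \<otimes> bd\<close>; \<open>triple_mult\<close> is \<open>a \<otimes> b \<otimes> c \<mapsto> abc\<close>.\<close>

definition tensor_mult ::
  "(('m \<Rightarrow>\<^sub>0 complex) \<Rightarrow> ('m \<Rightarrow>\<^sub>0 complex) \<Rightarrow> ('m \<Rightarrow>\<^sub>0 complex)) \<Rightarrow>
     ('m \<times> 'm \<Rightarrow>\<^sub>0 complex) \<Rightarrow> ('m \<times> 'm \<Rightarrow>\<^sub>0 complex) \<Rightarrow> ('m \<times> 'm \<Rightarrow>\<^sub>0 complex)" where
  "tensor_mult \<mu> s t =
     lin_ext (\<lambda>(u, v). lin_ext (\<lambda>(u', v').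
       tensor (\<mu> (basis u) (basis u')) (\<mu> (basis v) (basis v'))) t) s"

definition triple_mult ::
  "(('m \<Rightarrow>\<^sub>0 complex) \<Rightarrow> ('m \<Rightarrow>\<^sub>0 complex) \<Rightarrow> ('m \<Rightarrow>\<^sub>0 complex)) \<Rightarrow>
     (('m \<times> 'm) \<times> 'm \<Rightarrow>\<^sub>0 complex) \<Rightarrow> ('m \<Rightarrow>\<^sub>0 complex)" where
  "triple_mult \<mu> = lin_ext (\<lambda>((u, v), w). \<mu> (\<mu> (basis u) (basis v)) (basis w))"

definition assoc_algebra ::
  "'m set \<Rightarrow> (('m \<Rightarrow>\<^sub>0 complex) \<Rightarrow> ('m \<Rightarrow>\<^sub>0 complex) \<Rightarrow> ('m \<Rightarrow>\<^sub>0 complex)) \<Rightarrow> bool" where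
  "assoc_algebra M \<mu> \<longleftrightarrow>
     (\<forall>x\<in>free_space M. linear_on_free M M (\<mu> x)) \<and>
     (\<forall>y\<in>free_space M. linear_on_free M M (\<lambda>x. \<mu> x y)) \<and>
     (\<forall>x\<in>free_space M. \<forall>y\<in>free_space M. \<forall>z\<in>free_space M. \<mu> (\<mu> x y) z = \<mu> x (\<mu> y z))"

definition comultiplication ::
  "'m set \<Rightarrow> (('m \<Rightarrow>\<^sub>0 complex) \<Rightarrow> ('m \<Rightarrow>\<^sub>0 complex) \<Rightarrow> ('m \<Rightarrow>\<^sub>0 complex)) \<Rightarrow>
     (('m \<Rightarrow>\<^sub>0 complex) \<Rightarrow> ('m \<times> 'm \<Rightarrow>\<^sub>0 complex)) \<Rightarrow> bool" where
  "comultiplication M \<mu> \<delta> \<longleftrightarrow>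
     linear_on_free M (M \<times> M) \<delta> \<and>
     (\<forall>x\<in>free_space M. \<forall>y\<in>free_space M. \<delta> (\<mu> x y) = tensor_mult \<mu> (\<delta> x) (\<delta> y)) \<and>
     (\<forall>x\<in>free_space M. tensor_assoc (tensor_map \<delta> id (\<delta> x)) = tensor_map id \<delta> (\<delta> x))"

text \<open>
  Weak Hopf algebras whose underlying vector space is presented by a basis \<open>M\<close>; the product,
  comultiplication and weak antipode are arbitrary.  A unit or counit is not part of the structure.
\<close>

definition weak_hopf_algebra ::
  "'m set \<Rightarrow> (('m \<Rightarrow>\<^sub>0 complex) \<Rightarrow> ('m \<Rightarrow>\<^sub>0 complex) \<Rightarrow> ('m \<Rightarrow>\<^sub>0 complex)) \<Rightarrow>
     (('m \<Rightarrow>\<^sub>0 complex) \<Rightarrow> ('m \<times> 'm \<Rightarrow>\<^sub>0 complex)) \<Rightarrow>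
     (('m \<Rightarrow>\<^sub>0 complex) \<Rightarrow> ('m \<Rightarrow>\<^sub>0 complex)) \<Rightarrow> bool" where
  "weak_hopf_algebra M \<mu> \<delta> T \<longleftrightarrow>
     assoc_algebra M \<mu> \<and> comultiplication M \<mu> \<delta> \<and> linear_on_free M M T \<and>
     (\<forall>x\<in>free_space M.
        triple_mult \<mu> (tensor_map (tensor_map id T) id (tensor_map \<delta> id (\<delta> x))) = x \<and>
        triple_mult \<mu> (tensor_map (tensor_map T id) T (tensor_map \<delta> id (\<delta> x))) = T x)"

definition sa_mult ::
  "('m \<Rightarrow> 'm \<Rightarrow> 'm) \<Rightarrow> ('m \<Rightarrow>\<^sub>0 complex) \<Rightarrow> ('m \<Rightarrow>\<^sub>0 complex) \<Rightarrow> ('m \<Rightarrow>\<^sub>0 complex)" where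
  "sa_mult mul x y = lin_ext (\<lambda>u. lin_ext (\<lambda>v. basis (mul u v)) y) x"

definition sa_comult :: "('m \<Rightarrow>\<^sub>0 complex) \<Rightarrow> ('m \<times> 'm \<Rightarrow>\<^sub>0 complex)" where
  "sa_comult = lin_ext (\<lambda>u. basis (u, u))"

definition sa_antipode :: "('m \<Rightarrow> 'm) \<Rightarrow> ('m \<Rightarrow>\<^sub>0 complex) \<Rightarrow> ('m \<Rightarrow>\<^sub>0 complex)" where
  "sa_antipode star = lin_ext (\<lambda>u. basis (star u))"

definition realize :: "('i op \<Rightarrow>\<^sub>0 complex) \<Rightarrow> 'i op" where
  "realize x = (\<Sum>V\<in>Poly_Mapping.keys x. cmul (Poly_Mapping.lookup x V) V)"

definition realize2 :: "('i op \<times> 'i op \<Rightarrow>\<^sub>0 complex) \<Rightarrow> ('i \<times> 'i) op" where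
  "realize2 t = (\<Sum>(V, W)\<in>Poly_Mapping.keys t. cmul (Poly_Mapping.lookup t (V, W)) (op_tensor V W))"

text \<open>
  Injectivity of \<open>realize\<close> makes the abstract algebra on the basis \<open>M\<close> a subalgebra of \<open>A\<close>, and
  injectivity of \<open>realize2\<close> its algebraic tensor square a subspace of the spatial one; under these
  embeddings \<open>\<Delta>\<close> restricts to \<open>\<delta>\<close>.
\<close>

definition contains_dense_weak_hopf_algebra ::
  "'i op set \<Rightarrow> ('i op \<Rightarrow> ('i \<times> 'i) op) \<Rightarrow> 'i op set \<Rightarrow>
     (('i op \<Rightarrow>\<^sub>0 complex) \<Rightarrow> ('i op \<Rightarrow>\<^sub>0 complex) \<Rightarrow> ('i op \<Rightarrow>\<^sub>0 complex)) \<Rightarrow>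
     (('i op \<Rightarrow>\<^sub>0 complex) \<Rightarrow> ('i op \<times> 'i op \<Rightarrow>\<^sub>0 complex)) \<Rightarrow>
     (('i op \<Rightarrow>\<^sub>0 complex) \<Rightarrow> ('i op \<Rightarrow>\<^sub>0 complex)) \<Rightarrow> bool" where
  "contains_dense_weak_hopf_algebra A \<Delta> M \<mu> \<delta> T \<longleftrightarrow>
     weak_hopf_algebra M \<mu> \<delta> T \<and>
     inj_on realize (free_space M) \<and> inj_on realize2 (free_space (M \<times> M)) \<and>
     (\<forall>x\<in>free_space M. \<forall>y\<in>free_space M. realize (\<mu> x y) = realize x o\<^sub>L realize y) \<and>
     (\<forall>x\<in>free_space M. \<Delta> (realize x) = realize2 (\<delta> x)) \<and>
     realize ` free_space M \<subseteq> A \<and> A \<subseteq> closure (realize ` free_space M)"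

end

theory Submission
  imports Defs
begin

text \<open>
  Monomials are partial translations of \<open>S\<close> with nonempty domain, and partial translations form an
  inverse semigroup.  The finite combinations of monomials are dense in \<open>C\<^sup>*\<^sub>r\<^sub>e\<^sub>d(S)\<close>, so linearity,
  multiplicativity, \<open>*\<close>-preservation and coassociativity of \<open>\<Delta>\<close> pass from monomials to the closure.

  Extending \<open>\<Delta> \<otimes> id\<close> to the minimal tensor product needs \<open>\<Delta>\<close> to be contractive on matrices over the
  algebra.  Continuity gives a bound depending on the matrix size, which the \<open>C\<^sup>*\<close>-identity improves to
  \<open>1\<close>; hence applying \<open>\<Delta>\<close> to every matrix entry of an operator over the second tensor factor gives a
  bounded operator.

  That \<open>\<complex>[\<Sigma>]\<close> embeds is a consequence of the existence of \<open>\<Delta>\<close>: it makes monomials group-like, and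
  distinct nonzero group-like elements are linearly independent.
\<close>

section \<open>Operators on \<open>\<ell>\<^sup>2\<close> and adjoints\<close>

text \<open>Norm continuity of a linear map does not by itself allow tensoring it with the identity;
  this obstacle is behind most of the analysis. Contractivity of star-homomorphisms is obtained
  without spectral theory, and the extension is built directly as an infinite matrix of operators
  rather than as a limit of its values on sums of elementary tensors. \<open>adj\<close> and
  \<open>op_tensor\<close> are definite descriptions over real-linear operators, so they carry
  information only once existence has been shown, and complex linearity is what makes existence
  provable. Adjoints and infinite block matrices both arise from bounded families of rows;
  identities between operators are mostly read off from matrix entries. The assumption on
  combinations speaks of arbitrary coefficients on a finite set of distinct operators. It therefore
  forces every linear relation among monomials \<open>V\<close> to persist when each
  \<open>V\<close> is replaced by \<open>op_tensor V V\<close>. Distinct monomials cannot satisfy a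
  nontrivial relation that survives this.\<close>

lemma coord_diff [simp]: "coord (f - g) x = coord f x - coord g x"
  unfolding minus_ell2_def plus_ell2.rep_eq uminus_ell2.rep_eq by simp

lemma coord_simps [simp]:
  "coord (f + g) x = coord f x + coord g x"
  "coord (- f) x = - coord f x"
  "coord 0 x = 0"
  "coord (r *\<^sub>R f) x = of_real r * coord f x"
  "coord (cscale c f) x = c * coord f x"
  "coord (ket a) x = (if x = a then 1 else 0)"
  "coord (restrict_vec X f) x = (if x \<in> X then coord f x else 0)"
  "coord (vec_tensor f h) (x, y) = coord f x * coord h y"
  by (simp_all add: plus_ell2.rep_eq uminus_ell2.rep_eq zero_ell2.rep_eq
      scaleR_ell2.rep_eq cscale.rep_eq ket.rep_eq restrict_vec.rep_eq vec_tensor.rep_eq)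

lemma ell2_eqI: "(\<And>x. coord f x = coord g x) \<Longrightarrow> f = g"
  by (metis coord_inject ext)

lemma coord_sum [simp]: "coord (\<Sum>i\<in>I. f i) x = (\<Sum>i\<in>I. coord (f i) x)"
  by (induction I rule: infinite_finite_induct) auto

lemma norm_ell2_sq: "(norm f)\<^sup>2 = (\<Sum>\<^sub>\<infinity>x. (cmod (coord f x))\<^sup>2)"
  by (simp add: norm_ell2_eq infsum_nonneg)

lemma sum_coord_le: "finite F \<Longrightarrow> (\<Sum>x\<in>F. (cmod (coord f x))\<^sup>2) \<le> (norm f)\<^sup>2"
  unfolding norm_ell2_sq by (rule finite_sum_le_infsum[OF coord_summable]) auto

lemma norm_coord_le: "cmod (coord f x) \<le> norm f"
  using sum_coord_le[of "{x}" f] by (auto intro!: power2_le_imp_le[OF _ norm_ge_zero])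

lemma norm_le_finiteI:
  assumes "0 \<le> K" "\<And>F. finite F \<Longrightarrow> (\<Sum>x\<in>F. (cmod (coord f x))\<^sup>2) \<le> K\<^sup>2"
  shows "norm f \<le> K"
proof (rule power2_le_imp_le)
  show "(norm f)\<^sup>2 \<le> K\<^sup>2"
    unfolding norm_ell2_sq by (rule infsum_le_finite_sums[OF coord_summable]) (use assms in auto)
qed (use assms in auto)

lemma norm_finite_support:
  assumes "finite F" "\<And>x. x \<notin> F \<Longrightarrow> coord f x = 0"
  shows "(norm f)\<^sup>2 = (\<Sum>x\<in>F. (cmod (coord f x))\<^sup>2)"
proof -
  have "(\<Sum>\<^sub>\<infinity>x. (cmod (coord f x))\<^sup>2) = (\<Sum>\<^sub>\<infinity>x\<in>F. (cmod (coord f x))\<^sup>2)"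
    by (rule infsum_cong_neutral) (use assms in auto)
  then show ?thesis using assms(1) by (simp add: norm_ell2_sq)
qed

lemma Abs_ell2_ex:
  assumes "\<And>F. finite F \<Longrightarrow> (\<Sum>x\<in>F. (cmod (u x))\<^sup>2) \<le> B"
  shows "\<exists>f :: 'i ell2. \<forall>x. coord f x = u x"
proof -
  have "(\<lambda>x. (cmod (u x))\<^sup>2) summable_on UNIV"
    by (rule nonneg_bdd_above_summable_on) (use assms in \<open>auto intro!: bdd_aboveI[of _ B]\<close>)
  then show ?thesis by (intro exI[of _ "Abs_ell2 u"]) (simp add: Abs_ell2_inverse)
qed

lemma bounded_linear_coord: "bounded_linear (\<lambda>f. coord f x)"
  by (rule bounded_linear_intro[where K = 1])
    (auto simp: norm_coord_le scaleR_conv_of_real)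

lemma norm_cscale [simp]: "norm (cscale c f) = cmod c * norm f"
proof -
  have "(norm (cscale c f))\<^sup>2 = (cmod c * norm f)\<^sup>2"
    by (simp add: norm_ell2_sq norm_mult power_mult_distrib infsum_cmult_right')
  then show ?thesis by (simp add: power2_eq_iff_nonneg)
qed

lemma cscale_simps [simp]:
  "cscale c (f + g) = cscale c f + cscale c g"
  "cscale c (f - g) = cscale c f - cscale c g"
  "cscale c 0 = 0" "cscale 0 f = 0" "cscale 1 f = f"
  "cscale c (cscale d f) = cscale (c * d) f"
  by (auto intro!: ell2_eqI simp: algebra_simps)

lemma cscale_of_real: "cscale (of_real r) f = r *\<^sub>R f"
  by (auto intro!: ell2_eqI)

lemma bounded_linear_cscale: "bounded_linear (cscale c)"
  by (rule bounded_linear_intro[where K = "cmod c"])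
    (auto intro!: ell2_eqI simp: algebra_simps)

lemma restrict_vec_finite:
  "finite F \<Longrightarrow> restrict_vec F f = (\<Sum>a\<in>F. cscale (coord f a) (ket a))"
  by (rule ell2_eqI) (auto simp: if_distrib sum.delta cong: if_cong)

text \<open>The squared distance from \<open>f\<close> to its truncation is the total sum minus a
  finite partial sum, so convergence is that of the defining sum of the norm. This gives density of
  finite combinations of kets.\<close>

lemma restrict_vec_tendsto:
  "((\<lambda>F. restrict_vec F f) \<longlongrightarrow> f) (finite_subsets_at_top UNIV)"
proof -
  have "((\<lambda>F. \<Sum>x\<in>F. (cmod (coord f x))\<^sup>2) \<longlongrightarrow> (norm f)\<^sup>2) (finite_subsets_at_top UNIV)"
    using has_sum_infsum[OF coord_summable[of f]] unfolding has_sum_def norm_ell2_sq .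
  then have "((\<lambda>F. sqrt ((norm f)\<^sup>2 - (\<Sum>x\<in>F. (cmod (coord f x))\<^sup>2))) \<longlongrightarrow> sqrt ((norm f)\<^sup>2 - (norm f)\<^sup>2))
      (finite_subsets_at_top UNIV)"
    by (intro tendsto_intros)
  then have lim: "((\<lambda>F. sqrt ((norm f)\<^sup>2 - (\<Sum>x\<in>F. (cmod (coord f x))\<^sup>2))) \<longlongrightarrow> 0)
      (finite_subsets_at_top UNIV)" by simp
  have eq: "norm (restrict_vec F f - f) = sqrt ((norm f)\<^sup>2 - (\<Sum>x\<in>F. (cmod (coord f x))\<^sup>2))"
    if "finite F" for F
  proof -
    let ?u = "\<lambda>x. (cmod (coord f x))\<^sup>2"
    have sF: "(\<lambda>x. if x \<in> F then ?u x else 0) summable_on UNIV"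
      by (subst summable_on_cong_neutral[of F _ ?u]) (use that in auto)
    have e: "(cmod (coord (restrict_vec F f - f) x))\<^sup>2 = ?u x + - (if x \<in> F then ?u x else 0)" for x
      by auto
    have "(norm (restrict_vec F f - f))\<^sup>2 = (\<Sum>\<^sub>\<infinity>x. ?u x + - (if x \<in> F then ?u x else 0))"
      unfolding norm_ell2_sq by (rule infsum_cong) (rule e)
    also have "\<dots> = (\<Sum>\<^sub>\<infinity>x. ?u x) + (\<Sum>\<^sub>\<infinity>x. - (if x \<in> F then ?u x else 0))"
      by (rule infsum_add[OF coord_summable]) (use summable_on_uminus[of "\<lambda>x. if x \<in> F then ?u x else 0" UNIV] sF in blast)
    also have "(\<Sum>\<^sub>\<infinity>x. - (if x \<in> F then ?u x else 0)) = - (\<Sum>\<^sub>\<infinity>x. if x \<in> F then ?u x else 0)"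
      by (rule infsum_uminus)
    also have "(\<Sum>\<^sub>\<infinity>x. if x \<in> F then ?u x else 0) = (\<Sum>\<^sub>\<infinity>x\<in>F. ?u x)"
      by (rule infsum_cong_neutral) auto
    finally have "(norm (restrict_vec F f - f))\<^sup>2 = (norm f)\<^sup>2 - (\<Sum>x\<in>F. ?u x)"
      using that by (simp add: norm_ell2_sq)
    then show ?thesis by (rule real_sqrt_unique[symmetric, OF _ norm_ge_zero])
  qed
  show ?thesis
    unfolding tendsto_iff dist_norm
  proof safe
    fix e :: real assume "e > 0"
    then have "\<forall>\<^sub>F F in finite_subsets_at_top UNIV.
        norm (sqrt ((norm f)\<^sup>2 - (\<Sum>x\<in>F. (cmod (coord f x))\<^sup>2))) < e"
      using lim unfolding tendsto_iff dist_norm by simp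
    then show "\<forall>\<^sub>F F in finite_subsets_at_top UNIV. norm (restrict_vec F f - f) < e"
      using eventually_finite_subsets_at_top_weakI[of UNIV finite]
      by (auto elim!: eventually_elim2 simp flip: eq)
  qed
qed

text \<open>Agreement is asked on complex multiples of kets because \<open>p\<close> and
  \<open>q\<close> are only real-linear. In this form the rule also covers conjugate-linear maps
  such as the inner product in its first argument.\<close>

lemma bounded_linear_eq_on_kets:
  fixes p q :: "'i ell2 \<Rightarrow> 'b::real_normed_vector"
  assumes p: "bounded_linear p" and q: "bounded_linear q"
    and eq: "\<And>c a. p (cscale c (ket a)) = q (cscale c (ket a))"
  shows "p f = q f"
proof -
  have "p (restrict_vec F f) = q (restrict_vec F f)" if "finite F" for F
    using that by (simp add: restrict_vec_finite linear_sum[OF bounded_linear.linear[OF p]]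
        linear_sum[OF bounded_linear.linear[OF q]] eq)
  then have "\<forall>\<^sub>F F in finite_subsets_at_top UNIV. p (restrict_vec F f) = q (restrict_vec F f)"
    by (intro eventually_finite_subsets_at_top_weakI) auto
  moreover have "((\<lambda>F. p (restrict_vec F f)) \<longlongrightarrow> p f) (finite_subsets_at_top UNIV)"
    by (rule bounded_linear.tendsto[OF p restrict_vec_tendsto])
  moreover have "((\<lambda>F. q (restrict_vec F f)) \<longlongrightarrow> q f) (finite_subsets_at_top UNIV)"
    by (rule bounded_linear.tendsto[OF q restrict_vec_tendsto])
  ultimately show ?thesis
    using tendsto_unique[OF finite_subsets_at_top_neq_bot] tendsto_cong by fast
qed

section \<open>The complex inner product\<close>

lemma cinner_summable: "(\<lambda>x. cnj (coord f x) * coord g x) summable_on UNIV"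
  by (rule summable_Re_cnj_mult(1)[OF coord_summable coord_summable])

lemma cinner_add_right [simp]: "cinner f (g + h) = cinner f g + cinner f h"
  by (simp add: cinner.rep_eq distrib_left infsum_add cinner_summable)

lemma cinner_cscale_right [simp]: "cinner f (cscale c g) = c * cinner f g"
  by (simp add: cinner.rep_eq mult.left_commute infsum_cmult_right')

lemma cinner_commute: "cinner g f = cnj (cinner f g)"
  by (simp add: cinner.rep_eq mult.commute flip: infsum_cnj)

lemma cinner_add_left [simp]: "cinner (f + g) h = cinner f h + cinner g h"
  by (subst (1 2 3) cinner_commute) simp

lemma cinner_cscale_left [simp]: "cinner (cscale c f) g = cnj c * cinner f g"
  by (subst (1 2) cinner_commute) simp

lemma cinner_ket_left [simp]: "cinner (ket x) f = coord f x"
proof -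
  have "(\<Sum>\<^sub>\<infinity>y. cnj (coord (ket x) y) * coord f y) = (\<Sum>\<^sub>\<infinity>y\<in>{x}. coord f y)"
    by (rule infsum_cong_neutral) auto
  then show ?thesis by (simp add: cinner.rep_eq)
qed

lemma cinner_ket_right [simp]: "cinner f (ket x) = cnj (coord f x)"
  by (subst cinner_commute) simp

lemma Re_cinner: "Re (cinner f g) = inner f g"
  by (simp add: cinner.rep_eq inner_ell2.rep_eq infsum_Re[OF cinner_summable] del: times_complex.sel)

lemma cinner_self: "cinner f f = of_real ((norm f)\<^sup>2)"
proof -
  have "cinner f f = of_real (Re (cinner f f))"
    using cinner_commute[of f f] by (simp add: complex_eq_iff)
  then show ?thesis by (simp add: Re_cinner power2_norm_eq_inner)
qed

lemma cinner_Cauchy_Schwarz: "cmod (cinner f g) \<le> norm f * norm g"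
proof (cases "cinner f g = 0")
  case False
  \<comment> \<open>The phase that rotates the inner product onto the nonnegative reals, where the
    real Cauchy-Schwarz inequality applies.\<close>
  define u where "u = cnj (cinner f g) / of_real (cmod (cinner f g))"
  have u: "cmod u = 1" using False by (simp add: u_def norm_divide)
  have "cinner f (cscale u g) = of_real (cmod (cinner f g))"
    using False by (simp add: u_def complex_norm_square[symmetric] power2_eq_square mult.commute)
  then have "cmod (cinner f g) = inner f (cscale u g)"
    by (metis Re_cinner Re_complex_of_real)
  also have "\<dots> \<le> norm f * norm (cscale u g)" by (rule norm_cauchy_schwarz)
  finally show ?thesis by (simp add: u)
qed simp

lemma bounded_linear_cinner_left: "bounded_linear (\<lambda>f. cinner f g)"
  by (rule bounded_linear_intro[where K = "norm g"])
    (auto simp: cinner_Cauchy_Schwarz scaleR_conv_of_real simp flip: cscale_of_real)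

lemma cinner_sum_left: "cinner (\<Sum>i\<in>I. f i) g = (\<Sum>i\<in>I. cinner (f i) g)"
  by (rule linear_sum[OF bounded_linear.linear[OF bounded_linear_cinner_left]])

text \<open>Domain and codomain may differ, because the maps that cut an operator on a product into
  blocks are rectangular.\<close>

definition clin :: "('i ell2 \<Rightarrow>\<^sub>L 'j ell2) \<Rightarrow> bool" where
  "clin T \<longleftrightarrow> (\<forall>c f. T (cscale c f) = cscale c (T f))"

lemma clinD: "clin T \<Longrightarrow> T (cscale c f) = cscale c (T f)"
  by (simp add: clin_def)

lemma clin_eqI:
  assumes "clin T" "clin R" "\<And>x y. coord (T (ket y)) x = coord (R (ket y)) x"
  shows "T = R"
proof (rule blinfun_eqI)
  fix f
  have "T (ket y) = R (ket y)" for y using assms(3) by (rule ell2_eqI)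
  then show "T f = R f"
    using assms(1,2)
    by (auto intro: bounded_linear_eq_on_kets[of "blinfun_apply T" "blinfun_apply R"]
        simp: blinfun.bounded_linear_right clinD)
qed

lemma cmul_apply [simp]: "cmul c T f = cscale c (T f)"
  by (simp add: cmul_def scalar_op.rep_eq)

lemma clin_linear [simp, intro]:
  "clin 0"
  "clin T \<Longrightarrow> clin R \<Longrightarrow> clin (T + R)"
  "clin T \<Longrightarrow> clin R \<Longrightarrow> clin (T - R)"
  by (auto simp: clin_def blinfun.add_left blinfun.diff_left)

lemma clin_simps [simp, intro]: "clin T \<Longrightarrow> clin (cmul c T)" "clin (proj X)" "clin (shift S a)"
  by (auto simp: clin_def mult.commute proj.rep_eq shift.rep_eq shift_vec.rep_eq intro!: ell2_eqI)

lemma clin_compose [simp, intro]: "clin T \<Longrightarrow> clin R \<Longrightarrow> clin (T o\<^sub>L R)"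
  by (auto simp: clin_def)

lemma clin_sum [intro]: "(\<And>i. i \<in> I \<Longrightarrow> clin (T i)) \<Longrightarrow> clin (\<Sum>i\<in>I. T i)"
  by (induction I rule: infinite_finite_induct) auto

lemma closed_clin: "closed {T. clin T}"
  unfolding clin_def
  by (intro closed_Collect_all closed_Collect_eq continuous_intros
      bounded_linear.continuous_on[OF bounded_linear_cscale])

lemma cmul_simps [simp]:
  "cmul c (T + R) = cmul c T + cmul c R"
  "cmul c (cmul d T) = cmul (c * d) T"
  "cmul c 0 = 0" "cmul 0 T = 0" "cmul 1 T = T"
  by (auto intro!: blinfun_eqI simp: blinfun.add_left)

lemma cmul_of_real: "cmul (of_real r) T = r *\<^sub>R T"
  by (auto intro!: blinfun_eqI simp: blinfun.scaleR_left cscale_of_real)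

lemma cmul_add_left: "cmul (c + d) T = cmul c T + cmul d T"
  by (auto intro!: blinfun_eqI ell2_eqI simp: blinfun.add_left algebra_simps)

lemma cmul_sum: "cmul c (\<Sum>i\<in>I. T i) = (\<Sum>i\<in>I. cmul c (T i))"
  by (induction I rule: infinite_finite_induct) auto

lemma cmul_compose_left [simp]: "cmul c T o\<^sub>L R = cmul c (T o\<^sub>L R)"
  by (auto intro!: blinfun_eqI)

lemma cmul_compose_right [simp]: "clin T \<Longrightarrow> T o\<^sub>L cmul c R = cmul c (T o\<^sub>L R)"
  by (auto intro!: blinfun_eqI simp: clinD)

lemma bounded_linear_cmul: "bounded_linear (cmul c)"
  unfolding cmul_def by (rule bounded_bilinear.bounded_linear_right[OF bounded_bilinear_blinfun_compose])

lemma blinfun_compose_simps: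
  "(T + R) o\<^sub>L U = (T o\<^sub>L U) + (R o\<^sub>L U)" "U' o\<^sub>L (T' + R') = (U' o\<^sub>L T') + (U' o\<^sub>L R')"
  "(\<Sum>i\<in>I. V i) o\<^sub>L W = (\<Sum>i\<in>I. V i o\<^sub>L W)" "W' o\<^sub>L (\<Sum>i\<in>I. V' i) = (\<Sum>i\<in>I. W' o\<^sub>L V' i)"
  by (simp_all add: bounded_bilinear.add_left[OF bounded_bilinear_blinfun_compose]
      bounded_bilinear.add_right[OF bounded_bilinear_blinfun_compose]
      bounded_bilinear.sum_left[OF bounded_bilinear_blinfun_compose]
      bounded_bilinear.sum_right[OF bounded_bilinear_blinfun_compose])

text \<open>The hypothesis bounds the formal adjoint of the operator with rows \<open>r x\<close>.\<close>

lemma operator_of_rows: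
  fixes r :: "'j \<Rightarrow> 'i ell2"
  assumes K: "0 \<le> K"
    and bound: "\<And>F c. finite F \<Longrightarrow>
      norm (\<Sum>x\<in>F. cscale (c x) (r x)) \<le> K * sqrt (\<Sum>x\<in>F. (cmod (c x))\<^sup>2)"
  shows "\<exists>U :: 'i ell2 \<Rightarrow>\<^sub>L 'j ell2. clin U \<and> norm U \<le> K \<and> (\<forall>f x. coord (U f) x = cinner (r x) f)"
proof -
  have fin: "(\<Sum>x\<in>F. (cmod (cinner (r x) f))\<^sup>2) \<le> (K * norm f)\<^sup>2" if "finite F" for F f
  proof -
    \<comment> \<open>Duality: with these coefficients the sum of squares \<open>s\<^sup>2\<close>
      is itself an inner product with \<open>f\<close>, so the hypothesis yields
      \<open>s\<^sup>2 \<le> K * s * norm f\<close>, and one factor \<open>s\<close>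
      cancels.\<close>
    define c where "c x = cinner (r x) f" for x
    define s where "s = sqrt (\<Sum>x\<in>F. (cmod (c x))\<^sup>2)"
    have s: "0 \<le> s" "s\<^sup>2 = (\<Sum>x\<in>F. (cmod (c x))\<^sup>2)"
      by (auto simp: s_def sum_nonneg)
    have "cinner (\<Sum>x\<in>F. cscale (c x) (r x)) f = of_real (s\<^sup>2)"
      by (simp add: s cinner_sum_left flip: c_def) (simp add: complex_norm_square[unfolded of_real_power] mult.commute)
    then have "s\<^sup>2 = cmod (cinner (\<Sum>x\<in>F. cscale (c x) (r x)) f)"
      by (simp only: norm_of_real abs_power2)
    also have "\<dots> \<le> norm (\<Sum>x\<in>F. cscale (c x) (r x)) * norm f" by (rule cinner_Cauchy_Schwarz)
    also have "\<dots> \<le> K * s * norm f"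
      unfolding s_def by (intro mult_right_mono bound that) auto
    finally have "s * s \<le> s * (K * norm f)" by (simp add: power2_eq_square mult_ac)
    then have "s \<le> K * norm f"
      using s(1) K by (cases "s = 0") (auto simp: mult_le_cancel_left)
    then have "s\<^sup>2 \<le> (K * norm f)\<^sup>2" using s(1) by (rule power_mono)
    then show ?thesis by (simp add: s c_def)
  qed
  have "\<exists>h. \<forall>x. coord h x = cinner (r x) f" for f
    by (rule Abs_ell2_ex) (rule fin)
  then obtain U where U: "\<And>f x. coord (U f) x = cinner (r x) f" by metis
  have n: "norm (U f) \<le> norm f * K" for f
    by (rule norm_le_finiteI) (use fin K in \<open>auto simp: U mult.commute\<close>)
  have bl: "bounded_linear U"
    by (rule bounded_linear_intro[OF _ _ n])
      (auto intro!: ell2_eqI simp: U simp flip: cscale_of_real)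
  have "norm (Blinfun U) \<le> K"
    by (rule norm_blinfun_bound[OF K]) (use n in \<open>simp add: bounded_linear_Blinfun_apply[OF bl] mult.commute\<close>)
  moreover have "clin (Blinfun U)"
    by (auto simp: clin_def bounded_linear_Blinfun_apply[OF bl] U intro!: ell2_eqI)
  ultimately show ?thesis
    by (intro exI[of _ "Blinfun U"]) (simp add: bounded_linear_Blinfun_apply[OF bl] U)
qed

section \<open>Adjoints and the norm identity for them\<close>

lemma norm_ket_combination:
  assumes "finite F"
  shows "norm (\<Sum>x\<in>F. cscale (c x) (ket x)) = sqrt (\<Sum>x\<in>F. (cmod (c x))\<^sup>2)"
proof -
  have co: "coord (\<Sum>x\<in>F. cscale (c x) (ket x)) y = (if y \<in> F then c y else 0)" for y
    using assms by (simp add: if_distrib sum.delta' cong: if_cong)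
  have "(norm (\<Sum>x\<in>F. cscale (c x) (ket x)))\<^sup>2 = (\<Sum>x\<in>F. (cmod (c x))\<^sup>2)"
    by (subst norm_finite_support[OF assms]) (auto simp only: co if_True if_False intro!: sum.cong)
  then show ?thesis by (rule real_sqrt_unique[symmetric, OF _ norm_ge_zero])
qed

text \<open>Coordinate \<open>x\<close> of the adjoint at \<open>g\<close> must be the inner product
  of \<open>T (ket x)\<close> with \<open>g\<close>, so the vectors \<open>T (ket x)\<close> are its
  rows. Their finite combinations are values of \<open>T\<close>, which bounds them by
  \<open>norm T\<close>.\<close>

lemma adjoint_ex:
  fixes T :: "'i ell2 \<Rightarrow>\<^sub>L 'j ell2"
  assumes "clin T"
  shows "\<exists>R :: 'j ell2 \<Rightarrow>\<^sub>L 'i ell2. clin R \<and> norm R \<le> norm T \<and> (\<forall>f g. cinner (T f) g = cinner f (R g))"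
proof -
  have "norm (\<Sum>x\<in>F. cscale (c x) (T (ket x))) \<le> norm T * sqrt (\<Sum>x\<in>F. (cmod (c x))\<^sup>2)"
    if "finite F" for F c
  proof -
    have "(\<Sum>x\<in>F. cscale (c x) (T (ket x))) = T (\<Sum>x\<in>F. cscale (c x) (ket x))"
      by (simp add: blinfun.sum_right clinD[OF assms])
    then show ?thesis using norm_blinfun[of T] norm_ket_combination[OF that] by metis
  qed
  from operator_of_rows[of "norm T" "\<lambda>x. T (ket x)", OF norm_ge_zero this]
  obtain R where R: "clin R" "norm R \<le> norm T" "\<And>f x. coord (R f) x = cinner (T (ket x)) f"
    by auto
  have "cinner (T f) g = cinner f (R g)" for f g
    by (rule bounded_linear_eq_on_kets[of "\<lambda>f. cinner (T f) g"])
      (auto intro: bounded_linear_compose[OF bounded_linear_cinner_left] blinfun.bounded_linear_right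
        bounded_linear_cinner_left simp: clinD[OF assms] R)
  with R show ?thesis by blast
qed

lemma adj_eqI:
  fixes T R :: "'i op"
  assumes "\<And>f g. cinner (T f) g = cinner f (R g)"
  shows "adj T = R"
  unfolding adj_def
proof (rule the_equality)
  fix R' :: "'i op" assume R': "\<forall>f g. cinner (T f) g = cinner f (R' g)"
  show "R' = R"
  proof (intro blinfun_eqI ell2_eqI)
    fix g x show "coord (R' g) x = coord (R g) x"
      using R' assms by (metis cinner_ket_left)
  qed
qed (use assms in auto)

lemma adj:
  fixes T :: "'i op"
  assumes "clin T"
  shows cinner_adj: "cinner (T f) g = cinner f (adj T g)"
    and clin_adj [simp]: "clin (adj T)" and norm_adj_le: "norm (adj T) \<le> norm T"
proof -
  obtain R where R: "clin R" "norm R \<le> norm T" "\<And>f g. cinner (T f) g = cinner f (R g)"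
    using adjoint_ex[OF assms] by auto
  have "adj T = R" by (rule adj_eqI) (rule R)
  then show "cinner (T f) g = cinner f (adj T g)" "clin (adj T)" "norm (adj T) \<le> norm T"
    using R by auto
qed

lemma coord_adj: "clin T \<Longrightarrow> coord (adj (T :: 'i op) (ket y)) x = cnj (coord (T (ket x)) y)"
  using cinner_adj[of T "ket x" "ket y"] by simp

lemma adj_adj [simp]: "clin T \<Longrightarrow> adj (adj T) = T"
  by (rule clin_eqI) (auto simp: coord_adj)

lemma norm_adj: "clin T \<Longrightarrow> norm (adj T) = norm T"
  by (metis adj_adj antisym clin_adj norm_adj_le)

lemma adj_add: "clin T \<Longrightarrow> clin R \<Longrightarrow> adj (T + R) = adj T + adj R"
  by (rule clin_eqI) (auto simp: coord_adj blinfun.add_left)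

lemma adj_diff: "clin T \<Longrightarrow> clin R \<Longrightarrow> adj (T - R) = adj T - adj R"
  by (rule clin_eqI) (auto simp: coord_adj blinfun.diff_left)

lemma adj_cmul: "clin T \<Longrightarrow> adj (cmul c T) = cmul (cnj c) (adj T)"
  by (rule clin_eqI) (auto simp: coord_adj)

lemma adj_compose: "clin T \<Longrightarrow> clin R \<Longrightarrow> adj (T o\<^sub>L R) = adj R o\<^sub>L adj T"
  by (rule adj_eqI) (simp add: cinner_adj)

lemma adj_proj [simp]: "adj (proj X) = proj X"
  by (rule clin_eqI) (auto simp: coord_adj proj.rep_eq)

lemma adj_zero [simp]: "adj 0 = 0"
  by (rule clin_eqI) (auto simp: coord_adj)

lemma tendsto_adj:
  assumes "\<And>n. clin (t n)" "clin T" "t \<longlonglongrightarrow> T"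
  shows "(\<lambda>n. adj (t n)) \<longlonglongrightarrow> adj T"
proof -
  have "(\<lambda>n. norm (t n - T)) \<longlonglongrightarrow> 0" using assms(3) by (simp add: LIM_zero tendsto_norm_zero)
  then have "(\<lambda>n. norm (adj (t n) - adj T)) \<longlonglongrightarrow> 0"
    using assms by (simp add: norm_adj flip: adj_diff)
  then show ?thesis by (rule LIM_zero_cancel[OF tendsto_norm_zero_cancel])
qed

text \<open>For the lower bound, the square of \<open>norm (T f)\<close> is the inner product of
  \<open>f\<close> with \<open>(adj T o\<^sub>L T) f\<close>, and Cauchy-Schwarz applies.\<close>

lemma norm_adj_compose_self:
  fixes T :: "'i op"
  assumes "clin T"
  shows "norm (adj T o\<^sub>L T) = (norm T)\<^sup>2"
proof (rule antisym)
  have "norm (adj T o\<^sub>L T) \<le> norm (adj T) * norm T" by (rule norm_blinfun_compose)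
  then show "norm (adj T o\<^sub>L T) \<le> (norm T)\<^sup>2"
    using assms by (simp add: norm_adj power2_eq_square)
  have "norm (T f) \<le> sqrt (norm (adj T o\<^sub>L T)) * norm f" for f
  proof (rule power2_le_imp_le)
    have "(norm (T f))\<^sup>2 = cmod (cinner f ((adj T o\<^sub>L T) f))"
      using assms by (simp flip: cinner_adj add: cinner_self norm_power)
    also have "\<dots> \<le> norm f * norm ((adj T o\<^sub>L T) f)" by (rule cinner_Cauchy_Schwarz)
    also have "\<dots> \<le> norm f * (norm (adj T o\<^sub>L T) * norm f)"
      by (intro mult_left_mono norm_blinfun norm_ge_zero)
    finally show "(norm (T f))\<^sup>2 \<le> (sqrt (norm (adj T o\<^sub>L T)) * norm f)\<^sup>2"
      by (simp add: power_mult_distrib power2_eq_square[of "norm f"] mult_ac)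
  qed auto
  then have "norm T \<le> sqrt (norm (adj T o\<^sub>L T))"
    by (intro norm_blinfun_bound) auto
  then show "(norm T)\<^sup>2 \<le> norm (adj T o\<^sub>L T)"
    using power_mono[of "norm T" "sqrt (norm (adj T o\<^sub>L T))" 2] by simp
qed

section \<open>Tensor products and block matrices\<close>

text \<open>Pulling back along a map that is not injective can leave the square-summable families.
  Replacing \<open>X\<close> by the empty set in that case makes the operator total and contractive
  without side conditions.\<close>

lift_definition reindex_vec :: "'i set \<Rightarrow> ('i \<Rightarrow> 'j) \<Rightarrow> 'j ell2 \<Rightarrow> 'i ell2"
  is "\<lambda>X h f x. if x \<in> (if inj_on h X then X else {}) then f (h x) else 0"
  by (rule summable_sq_reindex(1)) auto

lift_definition reindex :: "'i set \<Rightarrow> ('i \<Rightarrow> 'j) \<Rightarrow> 'j ell2 \<Rightarrow>\<^sub>L 'i ell2" is reindex_vec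
proof (rule ell2_contraction[where K = 1])
  fix X :: "'i set" and h :: "'i \<Rightarrow> 'j" and f
  show "(\<Sum>\<^sub>\<infinity>x. (cmod (coord (reindex_vec X h f) x))\<^sup>2) \<le> 1\<^sup>2 * (\<Sum>\<^sub>\<infinity>x. (cmod (coord f x))\<^sup>2)"
    using summable_sq_reindex(2)[where h = h and X = "if inj_on h X then X else {}", OF _ coord_summable[of f]]
    by (simp add: reindex_vec.rep_eq)
qed (transfer; auto)+

lemma coord_reindex: "inj_on h X \<Longrightarrow> coord (reindex X h f) x = (if x \<in> X then coord f (h x) else 0)"
  by (simp add: reindex.rep_eq reindex_vec.rep_eq)

lemma norm_reindex: "norm (reindex X h) \<le> 1"
proof (rule norm_blinfun_bound)
  fix f
  show "norm (reindex X h f) \<le> 1 * norm f"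
    unfolding norm_ell2_eq mult_1 reindex.rep_eq reindex_vec.rep_eq
    by (intro real_sqrt_le_mono summable_sq_reindex(2) coord_summable) auto
qed simp

lemma clin_reindex [simp, intro]: "clin (reindex X h)"
  by (auto simp: clin_def reindex.rep_eq reindex_vec.rep_eq intro!: ell2_eqI)

text \<open>\<open>emb c\<close> tensors with \<open>ket c\<close> on the right, and
  \<open>slice c\<close> is its adjoint; \<open>row x\<close> is the analogue of
  \<open>slice\<close> for the first coordinate. Being reindexings, all four maps are
  contractions.\<close>

definition emb :: "'j \<Rightarrow> 'i ell2 \<Rightarrow>\<^sub>L ('i \<times> 'j) ell2" where "emb c = reindex {p. snd p = c} fst"
definition slice :: "'j \<Rightarrow> ('i \<times> 'j) ell2 \<Rightarrow>\<^sub>L 'i ell2" where "slice c = reindex UNIV (\<lambda>x. (x, c))"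
definition row :: "'i \<Rightarrow> ('i \<times> 'j) ell2 \<Rightarrow>\<^sub>L 'j ell2" where "row x = reindex UNIV (\<lambda>c. (x, c))"
definition flip :: "('i \<times> 'j) ell2 \<Rightarrow>\<^sub>L ('j \<times> 'i) ell2" where "flip = reindex UNIV prod.swap"

lemma coord_block_maps [simp]:
  "coord (emb c f) p = (if snd p = c then coord f (fst p) else 0)"
  "coord (slice c h) x = coord h (x, c)"
  "coord (row x h) c = coord h (x, c)"
  "coord (flip h) q = coord h (prod.swap q)"
  unfolding emb_def slice_def row_def flip_def
  by (subst coord_reindex; auto simp: inj_on_def)+

lemma clin_block_maps [simp, intro]: "clin (emb c)" "clin (slice d)" "clin (row x)" "clin flip"
  by (simp_all add: emb_def slice_def row_def flip_def)

lemma norm_block_maps: "norm (emb c) \<le> 1" "norm (slice d) \<le> 1"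
  by (simp_all add: emb_def slice_def norm_reindex)

lemma emb_ket [simp]: "emb c (ket x) = ket (x, c)"
  by (rule ell2_eqI) (auto simp: prod_eq_iff)

lemma emb_vec_tensor: "emb c f = vec_tensor f (ket c)"
  by (rule ell2_eqI) auto

lemma slice_vec_tensor [simp]: "slice c (vec_tensor f g) = cscale (coord g c) f"
  by (rule ell2_eqI) auto

lemma row_vec_tensor [simp]: "row x (vec_tensor f g) = cscale (coord f x) g"
  by (rule ell2_eqI) auto

lemma flip_vec_tensor [simp]: "flip (vec_tensor f g) = vec_tensor g f"
  by (rule ell2_eqI) auto

lemma ket_Pair: "ket (a, b) = vec_tensor (ket a) (ket b)"
  by (rule ell2_eqI) (auto split: if_splits)

lemma vec_tensor_cscale [simp]: "vec_tensor (cscale c f) g = cscale c (vec_tensor f g)"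
  by (rule ell2_eqI) auto

lemma slice_eqI: "(\<And>c. slice c h = slice c h') \<Longrightarrow> h = h'"
proof (rule ell2_eqI)
  fix p assume "\<And>c. slice c h = slice c h'"
  then show "coord h p = coord h' p"
    using coord_block_maps(2)[of "snd p" h "fst p"] coord_block_maps(2)[of "snd p" h' "fst p"] by simp
qed

lemma slice_emb: "slice c o\<^sub>L emb d = (if c = d then id_blinfun else 0)"
  by (auto intro!: blinfun_eqI ell2_eqI)

text \<open>The slice map that applies the vector functional of \<open>ket c\<close> and
  \<open>ket d\<close> to the second factor. An operator on the product is thereby a matrix indexed
  by the second factor, with operators on the first factor as entries.\<close>

definition block :: "'j \<Rightarrow> 'j \<Rightarrow> ('i \<times> 'j) op \<Rightarrow> 'i op" where
  "block c d X = slice c o\<^sub>L X o\<^sub>L emb d"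

lemma coord_block [simp]: "coord (block c d X (ket y)) x = coord (X (ket (y, d))) (x, c)"
  by (simp add: block_def)

lemma clin_block [simp, intro]: "clin X \<Longrightarrow> clin (block c d X)"
  by (simp add: block_def)

lemma bounded_linear_block: "bounded_linear (block c d)"
  unfolding block_def
  by (intro bounded_linear_compose[OF bounded_bilinear.bounded_linear_left[OF bounded_bilinear_blinfun_compose]]
      bounded_bilinear.bounded_linear_right[OF bounded_bilinear_blinfun_compose])

lemma block_add: "block c d (X + Y) = block c d X + block c d Y"
  by (simp add: linear_add[OF bounded_linear.linear[OF bounded_linear_block]])

lemma block_cmul: "block c d (cmul z X) = cmul z (block c d X)"
  by (rule blinfun_eqI) (simp add: block_def clinD[OF clin_block_maps(2)])

lemma norm_compose_contractions_le:
  assumes "norm U \<le> 1" "norm W \<le> 1"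
  shows "norm (U o\<^sub>L V o\<^sub>L W) \<le> norm V"
proof -
  have "norm (U o\<^sub>L V o\<^sub>L W) \<le> norm (U o\<^sub>L V) * norm W"
    by (rule norm_blinfun_compose)
  also have "\<dots> \<le> norm (U o\<^sub>L V) * 1"
    by (intro mult_left_mono assms norm_ge_zero)
  also have "\<dots> \<le> (norm U * norm V) * 1"
    by (intro mult_right_mono norm_blinfun_compose) auto
  also have "\<dots> \<le> norm V"
    using mult_right_mono[OF assms(1) norm_ge_zero, of V] by simp
  finally show ?thesis .
qed

lemma norm_block_le: "norm (block c d X) \<le> norm X"
  unfolding block_def by (intro norm_compose_contractions_le norm_block_maps)

lemma block_eqI:
  assumes "clin X" "clin Y" "\<And>c d. block c d X = block c d Y"
  shows "X = Y"
proof (rule clin_eqI[OF assms(1,2)])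
  fix p q
  show "coord (X (ket q)) p = coord (Y (ket q)) p"
    using assms(3)[of "snd p" "snd q"] coord_block[of "snd p" "snd q" X "fst q" "fst p"]
      coord_block[of "snd p" "snd q" Y "fst q" "fst p"] by simp
qed

lemma sum_norm_row_le:
  assumes "finite F"
  shows "(\<Sum>x\<in>F. (norm (row x h))\<^sup>2) \<le> (norm h)\<^sup>2"
proof -
  let ?u = "\<lambda>p. (cmod (coord h p))\<^sup>2"
  have s: "?u summable_on F \<times> UNIV"
    by (rule summable_on_subset_banach[OF coord_summable]) auto
  have "(\<Sum>x\<in>F. (norm (row x h))\<^sup>2) = (\<Sum>\<^sub>\<infinity>x\<in>F. \<Sum>\<^sub>\<infinity>c. ?u (x, c))"
    using assms by (simp add: norm_ell2_sq)
  also have "\<dots> = infsum ?u (F \<times> UNIV)"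
    using infsum_Sigma'_banach[of "\<lambda>x c. ?u (x, c)" F "\<lambda>_. UNIV"] s by (simp add: case_prod_unfold)
  also have "\<dots> \<le> (norm h)\<^sup>2"
    unfolding norm_ell2_sq by (rule infsum_mono_neutral[OF s coord_summable]) auto
  finally show ?thesis .
qed

text \<open>Tensoring with the identity lets \<open>R\<close> act on each row separately, and the
  square of the norm is the sum of the squared norms of the rows.\<close>

lemma tensor_right_ex:
  fixes R :: "'j op"
  assumes "clin R"
  shows "\<exists>U :: ('i \<times> 'j) op. clin U \<and> (\<forall>f g. U (vec_tensor f g) = vec_tensor f (R g))"
proof -
  have fin: "(\<Sum>p\<in>G. (cmod (coord (R (row (fst p) h)) (snd p)))\<^sup>2) \<le> (norm R * norm h)\<^sup>2"
    if "finite G" for G and h :: "('i \<times> 'j) ell2"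
  proof -
    let ?u = "\<lambda>p. (cmod (coord (R (row (fst p) h)) (snd p)))\<^sup>2"
    \<comment> \<open>Enlarging \<open>G\<close> to a rectangle turns the sum into an iterated one,
      whose inner sums are parts of the norms of single rows.\<close>
    have "sum ?u G \<le> sum ?u (fst ` G \<times> snd ` G)"
      by (rule sum_mono2) (use that in \<open>auto intro: rev_image_eqI\<close>)
    also have "\<dots> = (\<Sum>x\<in>fst ` G. \<Sum>c\<in>snd ` G. (cmod (coord (R (row x h)) c))\<^sup>2)"
      by (simp add: sum.cartesian_product case_prod_unfold)
    also have "\<dots> \<le> (\<Sum>x\<in>fst ` G. (norm (R (row x h)))\<^sup>2)"
      by (intro sum_mono sum_coord_le) (use that in auto)
    also have "\<dots> \<le> (\<Sum>x\<in>fst ` G. (norm R * norm (row x h))\<^sup>2)"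
      by (intro sum_mono power_mono norm_blinfun) auto
    also have "\<dots> = (norm R)\<^sup>2 * (\<Sum>x\<in>fst ` G. (norm (row x h))\<^sup>2)"
      by (simp add: power_mult_distrib sum_distrib_left)
    also have "\<dots> \<le> (norm R)\<^sup>2 * (norm h)\<^sup>2"
      by (intro mult_left_mono sum_norm_row_le) (use that in auto)
    finally show ?thesis by (simp add: power_mult_distrib)
  qed
  have "\<exists>k. \<forall>p. coord k p = coord (R (row (fst p) h)) (snd p)" for h :: "('i \<times> 'j) ell2"
    by (rule Abs_ell2_ex) (rule fin)
  then obtain U where U: "\<And>(h :: ('i \<times> 'j) ell2) p. coord (U h) p = coord (R (row (fst p) h)) (snd p)"
    by metis
  have n: "norm (U h) \<le> norm h * norm R" for h
    by (rule norm_le_finiteI) (use fin in \<open>auto simp: U mult.commute[of "norm h"]\<close>)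
  have bl: "bounded_linear U"
    by (rule bounded_linear_intro[OF _ _ n])
      (auto intro!: ell2_eqI simp: U blinfun.add_right blinfun.scaleR_right)
  have "clin (Blinfun U)"
    by (auto simp: clin_def bounded_linear_Blinfun_apply[OF bl] U clinD[OF assms] clinD[OF clin_block_maps(3)]
        intro!: ell2_eqI)
  moreover have "U (vec_tensor f g) = vec_tensor f (R g)" for f g
    by (auto simp: U clinD[OF assms] intro!: ell2_eqI)
  ultimately show ?thesis
    by (intro exI[of _ "Blinfun U"]) (simp add: bounded_linear_Blinfun_apply[OF bl])
qed

text \<open>Only tensoring with an identity on the left needs estimates: the general operator is the
  composite of two such operators, one of them conjugated by \<open>flip\<close>. Kets of pairs are
  elementary tensors, which gives uniqueness.\<close>

lemma op_tensor_aux: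
  fixes T :: "'i op" and R :: "'j op"
  assumes "clin T" "clin R"
  shows "(\<forall>f g. op_tensor T R (vec_tensor f g) = vec_tensor (T f) (R g)) \<and> clin (op_tensor T R)"
proof -
  obtain U :: "('j \<times> 'i) op" where U: "clin U" "\<And>f g. U (vec_tensor f g) = vec_tensor f (T g)"
    using tensor_right_ex[OF assms(1)] by metis
  obtain V :: "('i \<times> 'j) op" where V: "clin V" "\<And>f g. V (vec_tensor f g) = vec_tensor f (R g)"
    using tensor_right_ex[OF assms(2)] by metis
  let ?W = "flip o\<^sub>L U o\<^sub>L flip o\<^sub>L V"
  have W: "clin ?W" "\<And>f g. ?W (vec_tensor f g) = vec_tensor (T f) (R g)"
    using U V by auto
  have "op_tensor T R = ?W"
    unfolding op_tensor_def
  proof (rule the_equality)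
    fix U' :: "('i \<times> 'j) op" assume U': "\<forall>f g. U' (vec_tensor f g) = vec_tensor (T f) (R g)"
    have "U' (cscale c (ket p)) = ?W (cscale c (ket p))" for c p
      using U' W(2) by (metis ket_Pair prod.collapse vec_tensor_cscale)
    then have "U' h = ?W h" for h
      by (rule bounded_linear_eq_on_kets[OF blinfun.bounded_linear_right blinfun.bounded_linear_right])
    then show "U' = ?W" by (rule blinfun_eqI)
  qed (use W in auto)
  then show ?thesis using W by simp
qed

lemma op_tensor_apply: "clin T \<Longrightarrow> clin R \<Longrightarrow> op_tensor T R (vec_tensor f g) = vec_tensor (T f) (R g)"
  using op_tensor_aux by blast

lemma clin_op_tensor [simp, intro]: "clin T \<Longrightarrow> clin R \<Longrightarrow> clin (op_tensor T R)"
  using op_tensor_aux by blast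

lemma op_tensor_ket [simp]:
  "clin T \<Longrightarrow> clin R \<Longrightarrow> op_tensor T R (ket p) = vec_tensor (T (ket (fst p))) (R (ket (snd p)))"
  by (metis op_tensor_apply ket_Pair prod.collapse)

lemma coord_vec_tensor [simp]: "coord (vec_tensor f g) p = coord f (fst p) * coord g (snd p)"
  by (metis coord_simps(8) prod.collapse)

text \<open>A slice of an elementary tensor is a scalar multiple of its first factor. The values of
  the amplification on elementary tensors and both independence arguments rest on this.\<close>

lemma block_op_tensor:
  "clin T \<Longrightarrow> clin R \<Longrightarrow> block c d (op_tensor T R) = cmul (coord (R (ket d)) c) T"
  by (rule blinfun_eqI) (simp add: block_def emb_vec_tensor op_tensor_apply)

lemma op_tensor_cmul_left: "clin T \<Longrightarrow> clin R \<Longrightarrow> op_tensor (cmul c T) R = cmul c (op_tensor T R)"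
  by (rule clin_eqI) auto

lemma op_tensor_compose:
  assumes "clin T" "clin R" "clin T'" "clin R'"
  shows "op_tensor T R o\<^sub>L op_tensor T' R' = op_tensor (T o\<^sub>L T') (R o\<^sub>L R')"
  using assms by (intro clin_eqI) (auto simp: op_tensor_apply)

lemma adj_op_tensor:
  assumes "clin T" "clin R"
  shows "adj (op_tensor T R) = op_tensor (adj T) (adj R)"
  using assms by (intro clin_eqI) (auto simp: coord_adj)

lemma flip_op_tensor:
  assumes "clin T" "clin R"
  shows "flip o\<^sub>L op_tensor T R o\<^sub>L flip = op_tensor R T"
proof (rule clin_eqI)
  fix p q
  show "coord ((flip o\<^sub>L op_tensor T R o\<^sub>L flip) (ket q)) p = coord (op_tensor R T (ket q)) p"
    using assms by (cases q) (simp add: ket_Pair op_tensor_apply)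
qed (use assms in auto)

section \<open>Minimal tensor products\<close>

lemma min_tensor_induct [consumes 1, case_names tensor zero add scale closed]:
  assumes "X \<in> min_tensor A B"
    and "\<And>T R. T \<in> A \<Longrightarrow> R \<in> B \<Longrightarrow> P (op_tensor T R)"
    and "P 0" "\<And>X Y. P X \<Longrightarrow> P Y \<Longrightarrow> P (X + Y)" "\<And>r X. P X \<Longrightarrow> P (r *\<^sub>R X)"
    and "closed {X. P X}"
  shows "P X"
proof -
  have "span {op_tensor T R |T R. T \<in> A \<and> R \<in> B} \<subseteq> {X. P X}"
    by (rule span_minimal) (use assms(2-5) in \<open>auto simp: subspace_def\<close>)
  then show ?thesis
    using assms(1,6) closure_minimal unfolding min_tensor_def by blast
qed

lemma subspace_closure:
  fixes V :: "'a::real_normed_vector set"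
  assumes V: "subspace V"
  shows "subspace (closure V)"
proof (rule subspaceI)
  show "0 \<in> closure V"
    using subspace_0[OF V] closure_subset by blast
  fix x y assume "x \<in> closure V" "y \<in> closure V"
  then obtain s t where "\<And>n. s n \<in> V" "s \<longlonglongrightarrow> x" "\<And>n. t n \<in> V" "t \<longlonglongrightarrow> y"
    unfolding closure_sequential by blast
  then show "x + y \<in> closure V"
    unfolding closure_sequential
    by (intro exI[of _ "\<lambda>n. s n + t n"]) (auto intro: subspace_add[OF V] tendsto_add)
next
  fix x c assume "x \<in> closure V"
  then obtain s where "\<And>n. s n \<in> V" "s \<longlonglongrightarrow> x"
    unfolding closure_sequential by blast
  then show "c *\<^sub>R x \<in> closure V"
    unfolding closure_sequential
    by (intro exI[of _ "\<lambda>n. c *\<^sub>R s n"]) (auto intro: subspace_scale[OF V] tendsto_scaleR)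
qed

lemma min_tensor_simps:
  shows op_tensor_in_min_tensor: "T \<in> A \<Longrightarrow> R \<in> B \<Longrightarrow> op_tensor T R \<in> min_tensor A B"
    and min_tensor_add: "X \<in> min_tensor A B \<Longrightarrow> Y \<in> min_tensor A B \<Longrightarrow> X + Y \<in> min_tensor A B"
    and min_tensor_scaleR: "X \<in> min_tensor A B \<Longrightarrow> r *\<^sub>R X \<in> min_tensor A B"
    and min_tensor_zero: "0 \<in> min_tensor A B"
    and closed_min_tensor: "closed (min_tensor A B)"
proof -
  have s: "subspace (min_tensor A B)"
    unfolding min_tensor_def by (rule subspace_closure[OF subspace_span])
  then show "X \<in> min_tensor A B \<Longrightarrow> Y \<in> min_tensor A B \<Longrightarrow> X + Y \<in> min_tensor A B"
    "X \<in> min_tensor A B \<Longrightarrow> r *\<^sub>R X \<in> min_tensor A B" "0 \<in> min_tensor A B"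
    by (auto simp: subspace_def)
  show "T \<in> A \<Longrightarrow> R \<in> B \<Longrightarrow> op_tensor T R \<in> min_tensor A B"
    unfolding min_tensor_def by (rule subsetD[OF closure_subset]) (auto intro!: span_base)
  show "closed (min_tensor A B)" by (simp add: min_tensor_def)
qed

lemma min_tensor_flip:
  assumes "A \<subseteq> {T. clin T}" "B \<subseteq> {T. clin T}" "X \<in> min_tensor A B"
  shows "flip o\<^sub>L X o\<^sub>L flip \<in> min_tensor B A"
  using assms(3)
proof (induction rule: min_tensor_induct)
  case (tensor T R)
  then show ?case using assms(1,2) by (subst flip_op_tensor) (auto intro: op_tensor_in_min_tensor)
next
  case (add X Y)
  have "flip o\<^sub>L (X + Y) o\<^sub>L flip = (flip o\<^sub>L X o\<^sub>L flip) + (flip o\<^sub>L Y o\<^sub>L flip)"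
    by (simp add: blinfun_compose_simps)
  with add show ?case by (simp add: min_tensor_add)
next
  case (scale r X)
  have "flip o\<^sub>L (r *\<^sub>R X) o\<^sub>L flip = r *\<^sub>R (flip o\<^sub>L X o\<^sub>L flip)"
    by (rule blinfun_eqI) (simp add: blinfun.scaleR_left blinfun.scaleR_right)
  with scale show ?case by (simp add: min_tensor_scaleR)
next
  case closed
  have "closed ((\<lambda>X. flip o\<^sub>L X o\<^sub>L flip) -` min_tensor B A)"
    by (intro continuous_closed_vimage closed_min_tensor continuous_intros)
  then show ?case by (simp add: vimage_def)
qed (simp add: min_tensor_zero)

text \<open>Finite matrices of operators are realized on the full product space, with zero blocks
  off \<open>F\<close>. Their norm is thus an ordinary operator norm, and no finite index type has
  to be introduced.\<close>

definition blocks :: "'j set \<Rightarrow> ('j \<Rightarrow> 'j \<Rightarrow> 'i op) \<Rightarrow> ('i \<times> 'j) op" where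
  "blocks F M = (\<Sum>c\<in>F. \<Sum>d\<in>F. emb c o\<^sub>L M c d o\<^sub>L slice d)"

lemma slice_blocks:
  assumes "finite F"
  shows "slice c (blocks F M h) = (if c \<in> F then \<Sum>d\<in>F. M c d (slice d h) else 0)"
proof -
  have "slice c (blocks F M h) = (\<Sum>e\<in>F. \<Sum>d\<in>F. (slice c o\<^sub>L emb e) (M e d (slice d h)))"
    by (simp add: blocks_def blinfun.sum_left blinfun.sum_right)
  also have "\<dots> = (\<Sum>e\<in>F. if c = e then \<Sum>d\<in>F. M e d (slice d h) else 0)"
    by (intro sum.cong) (auto simp: slice_emb)
  finally show ?thesis using assms by simp
qed

lemma coord_blocks:
  assumes "finite F"
  shows "coord (blocks F M (ket (y, d))) (x, c) = (if c \<in> F \<and> d \<in> F then coord (M c d (ket y)) x else 0)"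
proof -
  have sl: "slice e (ket (y, d)) = (if e = d then ket y else 0)" for e
    by (auto intro!: ell2_eqI)
  have "coord (blocks F M (ket (y, d))) (x, c) = coord (slice c (blocks F M (ket (y, d)))) x"
    by simp
  also have "\<dots> = (if c \<in> F \<and> d \<in> F then coord (M c d (ket y)) x else 0)"
    using assms by (subst slice_blocks) (auto simp del: coord_block_maps simp: sl if_distrib cong: if_cong)
  finally show ?thesis .
qed

lemma clin_blocks: "(\<And>c d. c \<in> F \<Longrightarrow> d \<in> F \<Longrightarrow> clin (M c d)) \<Longrightarrow> clin (blocks F M)"
  unfolding blocks_def by (intro clin_sum clin_compose clin_block_maps) auto

lemma blocks_compose:
  assumes "finite F"
  shows "blocks F M o\<^sub>L blocks F N = blocks F (\<lambda>c d. \<Sum>e\<in>F. M c e o\<^sub>L N e d)"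
proof (intro blinfun_eqI slice_eqI)
  fix h c
  show "slice c ((blocks F M o\<^sub>L blocks F N) h) = slice c (blocks F (\<lambda>c d. \<Sum>e\<in>F. M c e o\<^sub>L N e d) h)"
    using assms by (auto simp: slice_blocks blinfun.sum_left blinfun.sum_right intro: sum.swap)
qed

lemma adj_blocks:
  assumes "finite F" "\<And>c d. clin (M c d)"
  shows "adj (blocks F M) = blocks F (\<lambda>c d. adj (M d c))"
proof (rule clin_eqI)
  fix p q
  show "coord (adj (blocks F M) (ket q)) p = coord (blocks F (\<lambda>c d. adj (M d c)) (ket q)) p"
    using assms by (cases p; cases q) (auto simp: coord_adj clin_blocks coord_blocks)
qed (use assms in \<open>auto intro!: clin_blocks clin_adj\<close>)

lemma block_blocks: 
  assumes "finite F" "c \<in> F" "d \<in> F" "\<And>c d. clin (M c d)"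
  shows "block c d (blocks F M) = M c d"
  by (rule clin_eqI) (use assms in \<open>auto simp: coord_blocks clin_blocks\<close>)

text \<open>A crude bound that grows with the size of \<open>F\<close>; this is harmless because it
  is applied to matrices whose norms are the powers \<open>2 ^ n\<close> of a fixed number.\<close>

lemma norm_blocks_le: "norm (blocks F M) \<le> (\<Sum>c\<in>F. \<Sum>d\<in>F. norm (M c d))"
  unfolding blocks_def
  by (intro sum_norm_le norm_compose_contractions_le norm_block_maps)

text \<open>The finite matrix cut out by \<open>F\<close> is the compression of \<open>X\<close> by
  the projection \<open>P\<close> onto the pairs with second coordinate in \<open>F\<close>.\<close>

lemma norm_blocks_block_le:
  fixes X :: "('i \<times> 'j) op"
  assumes "finite F" "clin X"
  shows "norm (blocks F (\<lambda>c d. block c d X)) \<le> norm X"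
proof -
  define P :: "('i \<times> 'j) op" where "P = reindex {p. snd p \<in> F} (\<lambda>p. p)"
  have P: "coord (P h) p = (if snd p \<in> F then coord h p else 0)" for h p
    unfolding P_def by (subst coord_reindex) auto
  have Pk: "P (ket q) = (if snd q \<in> F then ket q else 0)" for q
    by (rule ell2_eqI) (auto simp: P)
  have cP: "clin P" by (simp add: P_def)
  have "blocks F (\<lambda>c d. block c d X) = P o\<^sub>L X o\<^sub>L P"
  proof (rule clin_eqI)
    fix p q
    show "coord (blocks F (\<lambda>c d. block c d X) (ket q)) p = coord ((P o\<^sub>L X o\<^sub>L P) (ket q)) p"
      using assms by (cases p; cases q) (auto simp: coord_blocks P Pk)
  qed (use assms cP in \<open>auto intro!: clin_blocks\<close>)
  also have "norm \<dots> \<le> norm X"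
    unfolding P_def by (intro norm_compose_contractions_le norm_reindex)
  finally show ?thesis .
qed

text \<open>The operators \<open>Y\<close> for different \<open>F\<close> need not be compatible and
  are free outside \<open>F\<close>. The uniform bound alone suffices, since the norm of a finite
  combination of rows is tested on finitely many coordinates at a time.\<close>

lemma operator_of_matrix:
  fixes m :: "'i \<Rightarrow> 'i \<Rightarrow> complex"
  assumes K: "0 \<le> K"
    and Y: "\<And>F. finite F \<Longrightarrow> \<exists>Y :: 'i op. clin Y \<and> norm Y \<le> K \<and> (\<forall>p\<in>F. \<forall>q\<in>F. coord (Y (ket q)) p = m p q)"
  shows "\<exists>U :: 'i op. clin U \<and> norm U \<le> K \<and> (\<forall>p q. coord (U (ket q)) p = m p q)"
proof -
  \<comment> \<open>These are coordinates of \<open>adj Y\<close> at a finitely supported vector.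
    The bound is used twice: for a single index \<open>p\<close>, to see that each conjugated row is
    square-summable, and then for finite combinations of rows.\<close>
  have bd: "(\<Sum>q\<in>H. (cmod (\<Sum>p\<in>G. c p * cnj (m p q)))\<^sup>2) \<le> (K * sqrt (\<Sum>p\<in>G. (cmod (c p))\<^sup>2))\<^sup>2"
    if fin: "finite G" "finite H" for G H c
  proof -
    obtain Y :: "'i op" where Y: "clin Y" "norm Y \<le> K"
      and m: "\<And>p q. p \<in> G \<Longrightarrow> q \<in> H \<Longrightarrow> coord (Y (ket q)) p = m p q"
      using Y[of "G \<union> H"] fin by blast
    define v where "v = (\<Sum>p\<in>G. cscale (c p) (ket p))"
    have "coord (adj Y v) q = (\<Sum>p\<in>G. c p * cnj (m p q))" if "q \<in> H" for q
      using that Y(1) by (simp add: v_def blinfun.sum_right clinD clin_adj coord_adj m)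
    then have "(\<Sum>q\<in>H. (cmod (\<Sum>p\<in>G. c p * cnj (m p q)))\<^sup>2) = (\<Sum>q\<in>H. (cmod (coord (adj Y v) q))\<^sup>2)"
      by simp
    also have "\<dots> \<le> (norm (adj Y v))\<^sup>2" by (rule sum_coord_le[OF fin(2)])
    also have "norm (adj Y v) \<le> K * norm v"
    proof (rule order_trans[OF norm_blinfun])
      show "norm (adj Y) * norm v \<le> K * norm v"
        using Y norm_adj[OF Y(1)] by (intro mult_right_mono) auto
    qed
    then have "(norm (adj Y v))\<^sup>2 \<le> (K * norm v)\<^sup>2" by (rule power_mono) simp
    also have "norm v = sqrt (\<Sum>p\<in>G. (cmod (c p))\<^sup>2)"
      unfolding v_def by (rule norm_ket_combination[OF fin(1)])
    finally show ?thesis .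
  qed
  have "\<exists>r. \<forall>q. coord r q = cnj (m p q)" for p
    by (rule Abs_ell2_ex[of _ "K\<^sup>2"]) (use bd[of "{p}" _ "\<lambda>_. 1"] in simp)
  then obtain r where r: "\<And>p q. coord (r p) q = cnj (m p q)" by metis
  have "norm (\<Sum>p\<in>G. cscale (c p) (r p)) \<le> K * sqrt (\<Sum>p\<in>G. (cmod (c p))\<^sup>2)" if "finite G" for G c
    by (rule norm_le_finiteI) (use K that bd in \<open>auto simp: r sum_nonneg\<close>)
  from operator_of_rows[OF K this]
  obtain U where "clin U" "norm U \<le> K" "\<And>f x. coord (U f) x = cinner (r x) f"
    by blast
  then show ?thesis by (intro exI[of _ U]) (auto simp: r)
qed

section \<open>Amplification of continuous star-homomorphisms\<close>

text \<open>The entries of the adjoint of the matrix \<open>M\<close> times \<open>M\<close>.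
  Working with entries rather than with the assembled operator lets a star-homomorphism be applied
  entrywise and commute with the squaring.\<close>

definition msq :: "'j set \<Rightarrow> ('j \<Rightarrow> 'j \<Rightarrow> 'a op) \<Rightarrow> 'j \<Rightarrow> 'j \<Rightarrow> 'a op" where
  "msq F M = (\<lambda>c d. \<Sum>e\<in>F. adj (M e c) o\<^sub>L M e d)"

lemma norm_blocks_msq:
  assumes "finite F" "\<And>c d. clin (M c d)"
  shows "norm (blocks F ((msq F ^^ n) M)) = norm (blocks F M) ^ (2 ^ n)"
proof -
  have cl: "clin ((msq F ^^ n) M c d)" for n c d
    by (induction n arbitrary: c d) (auto simp: assms msq_def intro!: clin_sum)
  show ?thesis
  proof (induction n)
    case (Suc n)
    let ?N = "(msq F ^^ n) M"
    have "blocks F (msq F ?N) = adj (blocks F ?N) o\<^sub>L blocks F ?N"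
      using assms by (simp add: adj_blocks cl blocks_compose msq_def)
    then have "norm (blocks F (msq F ?N)) = (norm (blocks F ?N))\<^sup>2"
      by (simp add: norm_adj_compose_self clin_blocks cl)
    then show ?case by (simp add: Suc flip: power_mult) (simp add: mult.commute)
  qed simp
qed

locale continuous_star_hom =
  fixes X :: "'i set" and A :: "'i op set" and \<Delta> :: "'i op \<Rightarrow> 'k op"
  assumes alg: "cstar_subalgebra X A"
    and hom: "star_hom A {T. clin T} \<Delta>"
    and cont: "continuous_on A \<Delta>"
begin

lemma A_clin: "T \<in> A \<Longrightarrow> clin T"
  using alg by (auto simp: cstar_subalgebra_def bounded_ops_def clin_def)

lemma A_closed:
  "0 \<in> A" "T \<in> A \<Longrightarrow> R \<in> A \<Longrightarrow> T + R \<in> A" "T \<in> A \<Longrightarrow> R \<in> A \<Longrightarrow> T o\<^sub>L R \<in> A"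
  "T \<in> A \<Longrightarrow> cmul c T \<in> A" "T \<in> A \<Longrightarrow> adj T \<in> A" "closed A"
  using alg by (auto simp: cstar_subalgebra_def)

lemma A_scaleR: "T \<in> A \<Longrightarrow> r *\<^sub>R T \<in> A"
  using A_closed(4)[of T "of_real r"] by (simp add: cmul_of_real)

lemma A_sum: "(\<And>i. i \<in> I \<Longrightarrow> f i \<in> A) \<Longrightarrow> sum f I \<in> A"
  by (induction I rule: infinite_finite_induct) (auto intro: A_closed)

lemma hom_simps:
  "T \<in> A \<Longrightarrow> clin (\<Delta> T)"
  "T \<in> A \<Longrightarrow> R \<in> A \<Longrightarrow> \<Delta> (T + R) = \<Delta> T + \<Delta> R"
  "T \<in> A \<Longrightarrow> R \<in> A \<Longrightarrow> \<Delta> (T o\<^sub>L R) = \<Delta> T o\<^sub>L \<Delta> R"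
  "T \<in> A \<Longrightarrow> \<Delta> (cmul c T) = cmul c (\<Delta> T)"
  "T \<in> A \<Longrightarrow> \<Delta> (adj T) = adj (\<Delta> T)"
  using hom by (auto simp: star_hom_def clinear_map_on_def)

lemma hom_zero: "\<Delta> 0 = 0"
  using hom_simps(4)[OF A_closed(1), of 0] by simp

lemma hom_sum: "(\<And>i. i \<in> I \<Longrightarrow> f i \<in> A) \<Longrightarrow> \<Delta> (sum f I) = (\<Sum>i\<in>I. \<Delta> (f i))"
  by (induction I rule: infinite_finite_induct) (auto simp: hom_zero hom_simps A_sum)

lemma hom_bounded: "\<exists>C\<ge>0. \<forall>T\<in>A. norm (\<Delta> T) \<le> C * norm T"
proof -
  obtain d where d: "d > 0" "\<And>T. T \<in> A \<Longrightarrow> dist T 0 < d \<Longrightarrow> dist (\<Delta> T) (\<Delta> 0) < 1"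
    using cont A_closed(1) unfolding continuous_on_iff by (metis zero_less_one)
  have "norm (\<Delta> T) \<le> (2 / d) * norm T" if T: "T \<in> A" for T
  proof (cases "T = 0")
    case False
    \<comment> \<open>Half the radius \<open>d\<close> keeps the rescaled operator strictly inside
      the ball on which continuity bounds the image by 1.\<close>
    define r where "r = d / (2 * norm T)"
    have r: "r > 0" "r * norm T < d" using False d(1) by (auto simp: r_def field_simps)
    have "\<Delta> (r *\<^sub>R T) = r *\<^sub>R \<Delta> T"
      using hom_simps(4)[OF T, of "of_real r"] by (simp add: cmul_of_real)
    moreover have "norm (\<Delta> (r *\<^sub>R T)) < 1"
      using d(2)[OF A_scaleR[OF T, of r]] r by (simp add: hom_zero)
    ultimately have "r * norm (\<Delta> T) < 1" using r by simp
    then show ?thesis using False d(1) by (simp add: r_def field_simps)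
  qed (simp add: hom_zero)
  then show ?thesis using d(1) by (intro exI[of _ "2 / d"]) auto
qed

text \<open>
  The \<open>C\<^sup>*\<close>-identity upgrades boundedness to contractivity: replacing \<open>M\<close> by \<open>M\<^sup>* M\<close> squares both
  norms, so \<open>u ^ (2 ^ n) \<le> K * v ^ (2 ^ n)\<close> for all \<open>n\<close>.
\<close>

lemma blocks_contraction:
  assumes F: "finite F" and M: "\<And>c d. M c d \<in> A"
  shows "norm (blocks F (\<lambda>c d. \<Delta> (M c d))) \<le> norm (blocks F M)"
proof (rule ccontr)
  define u where "u = norm (blocks F (\<lambda>c d. \<Delta> (M c d)))"
  define v where "v = norm (blocks F M)"
  obtain C where C: "C \<ge> 0" "\<And>T. T \<in> A \<Longrightarrow> norm (\<Delta> T) \<le> C * norm T"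
    using hom_bounded by auto
  have MA: "(msq F ^^ n) M c d \<in> A" for n c d
    by (induction n arbitrary: c d) (auto simp: M msq_def intro!: A_sum A_closed)
  have hM: "(msq F ^^ n) (\<lambda>c d. \<Delta> (M c d)) = (\<lambda>c d. \<Delta> ((msq F ^^ n) M c d))" for n
  proof (induction n)
    case (Suc n)
    have "msq F (\<lambda>c d. \<Delta> (N c d)) = (\<lambda>c d. \<Delta> (msq F N c d))" if "\<And>c d. N c d \<in> A" for N
      by (auto simp: msq_def hom_sum hom_simps that A_closed intro!: ext)
    from this[OF MA] show ?case by (simp add: Suc)
  qed simp
  \<comment> \<open>The bound \<open>C\<close> once for each pair of indices in \<open>F\<close>: it
    depends on the matrix size but not on \<open>n\<close>.\<close>
  define K where "K = (\<Sum>c\<in>F. \<Sum>d\<in>F. C)"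
  have *: "u ^ (2 ^ n) \<le> K * v ^ (2 ^ n)" for n
  proof -
    let ?N = "(msq F ^^ n) M"
    have "u ^ (2 ^ n) = norm (blocks F (\<lambda>c d. \<Delta> (?N c d)))"
      unfolding u_def using norm_blocks_msq[OF F, of "\<lambda>c d. \<Delta> (M c d)" n] M hom_simps(1)
      by (simp add: hM)
    also have "\<dots> \<le> (\<Sum>c\<in>F. \<Sum>d\<in>F. norm (\<Delta> (?N c d)))" by (rule norm_blocks_le)
    also have "\<dots> \<le> (\<Sum>c\<in>F. \<Sum>d\<in>F. C * norm (blocks F ?N))"
    proof (intro sum_mono)
      fix c d assume cd: "c \<in> F" "d \<in> F"
      have "norm (\<Delta> (?N c d)) \<le> C * norm (?N c d)" by (rule C(2)[OF MA])
      also have "norm (?N c d) \<le> norm (blocks F ?N)"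
        using norm_block_le[of c d "blocks F ?N"] block_blocks[OF F cd A_clin[OF MA]] by simp
      then have "C * norm (?N c d) \<le> C * norm (blocks F ?N)"
        by (intro mult_left_mono C)
      finally show "norm (\<Delta> (?N c d)) \<le> C * norm (blocks F ?N)" .
    qed
    also have "\<dots> = K * norm (blocks F ?N)"
      by (simp add: K_def sum_distrib_right)
    also have "norm (blocks F ?N) = v ^ (2 ^ n)"
      unfolding v_def by (rule norm_blocks_msq[OF F A_clin[OF M]])
    finally show ?thesis .
  qed
  assume "\<not> ?thesis"
  then have vu: "v < u" by (simp add: u_def v_def)
  have v0: "v \<ge> 0" by (simp add: v_def)
  show False
  proof (cases "v = 0")
    case True
    then show False using *[of 0] vu by simp
  next
    case False
    then have "v > 0" using v0 by simp
    then have "u / v > 1" using vu by simp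
    \<comment> \<open>Some power of \<open>u / v\<close> exceeds \<open>K\<close>; since
      \<open>m \<le> 2 ^ m\<close>, the estimate at stage \<open>m\<close> contradicts it.\<close>
    then obtain m where m: "K < (u / v) ^ m" using real_arch_pow by blast
    also have "(u / v) ^ m \<le> (u / v) ^ (2 ^ m)"
      using \<open>u / v > 1\<close> by (intro power_increasing) auto
    also have "\<dots> \<le> K"
      using *[of m] \<open>v > 0\<close> by (simp add: power_divide divide_le_eq)
    finally show False by simp
  qed
qed

text \<open>A Fubini-type product of \<open>A\<close> with all complex-linear operators on the
  second factor. It is closed and contains the minimal tensor products, so the amplification can be
  defined entrywise on it before any approximation by elementary tensors.\<close>

definition sliceable :: "('i \<times> 'j) op set" where
  "sliceable = {Y. clin Y \<and> (\<forall>c d. block c d Y \<in> A)}"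

definition amplify :: "('i \<times> 'j) op \<Rightarrow> ('k \<times> 'j) op" where
  "amplify Y = (THE U. clin U \<and> (\<forall>c d. block c d U = \<Delta> (block c d Y)))"

text \<open>Each finite corner of the prescribed matrix comes from a finite block matrix, whose norm
  is controlled by \<open>blocks_contraction\<close> followed by compression. The bound
  \<open>norm Y\<close> is the same for all corners, so \<open>operator_of_matrix\<close> assembles
  them.\<close>

lemma amplify:
  fixes Y :: "('i \<times> 'j) op"
  assumes Y: "Y \<in> sliceable"
  shows clin_amplify: "clin (amplify Y)" and block_amplify: "block c d (amplify Y) = \<Delta> (block c d Y)"
    and norm_amplify_le: "norm (amplify Y) \<le> norm Y"
proof -
  have cY: "clin Y" and bY: "\<And>c d. block c d Y \<in> A" using Y by (auto simp: sliceable_def)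
  define m where "m p q = coord (\<Delta> (block (snd p) (snd q) Y) (ket (fst q))) (fst p)" for p q :: "'k \<times> 'j"
  have "\<exists>Z :: ('k \<times> 'j) op. clin Z \<and> norm Z \<le> norm Y \<and> (\<forall>p\<in>F. \<forall>q\<in>F. coord (Z (ket q)) p = m p q)"
    if F: "finite F" for F
  proof (intro exI conjI ballI)
    let ?Z = "blocks (snd ` F) (\<lambda>c d. \<Delta> (block c d Y))"
    have F': "finite (snd ` F)" using F by simp
    show "clin ?Z" by (intro clin_blocks hom_simps bY)
    have "norm ?Z \<le> norm (blocks (snd ` F) (\<lambda>c d. block c d Y))"
      by (rule blocks_contraction[OF F' bY])
    also have "\<dots> \<le> norm Y" by (rule norm_blocks_block_le[OF F' cY])
    finally show "norm ?Z \<le> norm Y" .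
    fix p q assume "p \<in> F" "q \<in> F"
    then show "coord (?Z (ket q)) p = m p q"
      using F' by (cases p; cases q) (force simp: coord_blocks m_def)
  qed
  from operator_of_matrix[OF norm_ge_zero this]
  obtain U :: "('k \<times> 'j) op" where U: "clin U" "norm U \<le> norm Y" "\<And>p q. coord (U (ket q)) p = m p q"
    by blast
  have bU: "block c d U = \<Delta> (block c d Y)" for c d
    using U(1) by (intro clin_eqI) (auto simp: U(3) m_def hom_simps bY)
  have "amplify Y = U"
    unfolding amplify_def
    by (rule the_equality) (use U(1) bU in \<open>auto intro: block_eqI\<close>)
  then show "clin (amplify Y)" "block c d (amplify Y) = \<Delta> (block c d Y)" "norm (amplify Y) \<le> norm Y"
    using U bU by auto
qed

lemma amplify_eqI:
  "Y \<in> sliceable \<Longrightarrow> clin U \<Longrightarrow> (\<And>c d. block c d U = \<Delta> (block c d Y)) \<Longrightarrow> amplify Y = U"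
  by (rule block_eqI) (auto simp: clin_amplify block_amplify)

lemma sliceable_simps:
  "0 \<in> sliceable"
  "Y \<in> sliceable \<Longrightarrow> Z \<in> sliceable \<Longrightarrow> Y + Z \<in> sliceable"
  "Y \<in> sliceable \<Longrightarrow> cmul z Y \<in> sliceable"
  "T \<in> A \<Longrightarrow> clin R \<Longrightarrow> op_tensor T R \<in> sliceable"
proof -
  show "0 \<in> sliceable"
    by (simp add: sliceable_def A_closed linear_0[OF bounded_linear.linear[OF bounded_linear_block]])
qed (auto simp: sliceable_def block_add block_cmul block_op_tensor A_closed A_clin)

lemma closed_sliceable: "closed sliceable"
proof -
  have "closed (block c d -` A)" for c d
    by (intro continuous_closed_vimage A_closed linear_continuous_at bounded_linear_block)
  then have "closed ({Y. clin Y} \<inter> (\<Inter>c d. block c d -` A))"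
    by (intro closed_Int closed_INT closed_clin ballI)
  also have "{Y. clin Y} \<inter> (\<Inter>c d. block c d -` A) = sliceable"
    by (auto simp: sliceable_def)
  finally show ?thesis .
qed

lemma min_tensor_sliceable:
  assumes "B \<subseteq> {R. clin R}" "Y \<in> min_tensor A B"
  shows "Y \<in> sliceable"
  using assms(2)
proof (induction rule: min_tensor_induct)
  case (scale r X)
  then show ?case using sliceable_simps(3)[of X "of_real r"] by (simp add: cmul_of_real)
qed (use assms(1) in \<open>auto intro: sliceable_simps closed_sliceable\<close>)

lemma amplify_add: "Y \<in> sliceable \<Longrightarrow> Z \<in> sliceable \<Longrightarrow> amplify (Y + Z) = amplify Y + amplify Z"
  by (rule amplify_eqI)
    (auto simp: sliceable_simps clin_amplify block_add block_amplify hom_simps A_closed sliceable_def[THEN eqset_imp_iff])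

lemma amplify_cmul: "Y \<in> sliceable \<Longrightarrow> amplify (cmul z Y) = cmul z (amplify Y)"
  by (rule amplify_eqI)
    (auto simp: sliceable_simps clin_amplify block_cmul block_amplify hom_simps A_closed sliceable_def[THEN eqset_imp_iff])

lemma amplify_op_tensor:
  assumes "T \<in> A" "clin R"
  shows "amplify (op_tensor T R) = op_tensor (\<Delta> T) R"
  using assms by (intro amplify_eqI) (auto simp: sliceable_simps block_op_tensor hom_simps A_clin)

lemma continuous_on_amplify: "continuous_on sliceable amplify"
proof -
  have "dist (amplify Y) (amplify Z) \<le> dist Y Z" if "Y \<in> sliceable" "Z \<in> sliceable" for Y Z
  proof -
    have "cmul (-1) V = - V" for V :: "('x \<times> 'y) op"
      using cmul_of_real[of "-1" V] by simp
    \<comment> \<open>Differences are written with a sum and a multiple by \<open>-1\<close>, the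
      two operations that \<open>amplify\<close> is known to respect on
      \<open>sliceable\<close>.\<close>
    then have m: "Y - Z = Y + cmul (-1) Z" "amplify Y - amplify Z = amplify Y + cmul (-1) (amplify Z)"
      using cmul_of_real[of "-1" Z] cmul_of_real[of "-1" "amplify Z"] by simp_all
    have "amplify Y - amplify Z = amplify (Y - Z)"
      using that by (simp only: m amplify_add amplify_cmul sliceable_simps)
    then show ?thesis
      using that norm_amplify_le[of "Y - Z"] by (simp only: dist_norm m sliceable_simps)
  qed
  then show ?thesis
    unfolding continuous_on_iff by (meson le_less_trans)
qed

lemma is_tensor_map_amplify:
  assumes "B \<subseteq> {R. clin R}"
  shows "is_tensor_map A B \<Delta> (\<lambda>T. T) amplify"
proof -
  have sub: "min_tensor A B \<subseteq> sliceable" using min_tensor_sliceable[OF assms] by blast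
  then show ?thesis
    unfolding is_tensor_map_def clinear_map_on_def
    using assms continuous_on_subset[OF continuous_on_amplify sub]
    by (auto simp: amplify_op_tensor intro!: amplify_add amplify_cmul)
qed

text \<open>Blocks are indexed by the second factor, so \<open>amplify\<close> acts on the first
  one; conjugating with \<open>flip\<close> moves the action to the second.\<close>

definition amplify_right :: "('j \<times> 'i) op \<Rightarrow> ('j \<times> 'k) op" where
  "amplify_right Y = flip o\<^sub>L amplify (flip o\<^sub>L Y o\<^sub>L flip) o\<^sub>L flip"

lemma is_tensor_map_amplify_right:
  assumes B: "B \<subseteq> {R. clin R}"
  shows "is_tensor_map B A (\<lambda>T. T) \<Delta> amplify_right"
proof -
  have sl: "flip o\<^sub>L Y o\<^sub>L flip \<in> sliceable" if "Y \<in> min_tensor B A" for Y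
    using min_tensor_flip[of B A Y] B A_clin that by (intro min_tensor_sliceable[OF B]) auto
  have "continuous_on (min_tensor B A) amplify_right"
    unfolding amplify_right_def
    by (intro continuous_intros continuous_on_compose2[OF continuous_on_amplify]) (use sl in auto)
  moreover have "amplify_right (Y + Z) = amplify_right Y + amplify_right Z"
    if "Y \<in> min_tensor B A" "Z \<in> min_tensor B A" for Y Z
    using sl[OF that(1)] sl[OF that(2)] by (simp add: amplify_right_def blinfun_compose_simps amplify_add)
  moreover have "amplify_right (cmul c Y) = cmul c (amplify_right Y)" if "Y \<in> min_tensor B A" for c Y
  proof -
    have *: "flip o\<^sub>L cmul c V o\<^sub>L flip = cmul c (flip o\<^sub>L V o\<^sub>L flip)" for V :: "('x \<times> 'y) op"
      by (rule blinfun_eqI) (simp add: clinD[OF clin_block_maps(4)])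
    have **: "flip o\<^sub>L cmul c V o\<^sub>L flip = cmul c (flip o\<^sub>L V o\<^sub>L flip)" for V :: "('k \<times> 'z) op"
      by (rule blinfun_eqI) (simp add: clinD[OF clin_block_maps(4)])
    show ?thesis using sl[OF that] unfolding amplify_right_def * by (simp only: amplify_cmul **)
  qed
  moreover have "amplify_right (op_tensor R T) = op_tensor R (\<Delta> T)" if "R \<in> B" "T \<in> A" for R T
  proof -
    have c: "clin R" "clin T" "clin (\<Delta> T)" using that B A_clin hom_simps(1) by auto
    show ?thesis
      using c that(2) by (simp add: amplify_right_def flip_op_tensor amplify_op_tensor)
  qed
  ultimately show ?thesis
    unfolding is_tensor_map_def clinear_map_on_def by blast
qed

end

section \<open>Monomials as partial translations\<close>

definition partial_translation :: "'g::ab_group_add op \<Rightarrow> 'g set \<Rightarrow> 'g \<Rightarrow> bool" where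
  "partial_translation V D d \<longleftrightarrow> clin V \<and> (\<forall>x. V (ket x) = (if x \<in> D then ket (x + d) else 0))"

lemma partial_translationD:
  "partial_translation V D d \<Longrightarrow> clin V"
  "partial_translation V D d \<Longrightarrow> V (ket x) = (if x \<in> D then ket (x + d) else 0)"
  by (auto simp: partial_translation_def)

lemma partial_translation_unique:
  "partial_translation V D d \<Longrightarrow> partial_translation W D d \<Longrightarrow> V = W"
  by (rule clin_eqI) (auto simp: partial_translationD)

lemma ket_inject [simp]: "ket x = ket y \<longleftrightarrow> x = y"
  by (metis coord_simps(6) zero_neq_one)

lemma ket_nonzero [simp]: "ket x \<noteq> 0" "0 \<noteq> ket x"
  by (metis coord_simps(3,6) zero_neq_one)+

text \<open>The point \<open>x\<close> of the domain is essential: with empty domain the operator is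
  zero and fits every translation vector.\<close>

lemma partial_translation_determined:
  assumes "partial_translation V D d" "partial_translation V E e" "x \<in> D"
  shows "D = E" "d = e"
proof -
  have *: "(if x \<in> D then ket (x + d) else 0) = (if x \<in> E then ket (x + e) else 0)" for x
    using assms(1,2)[THEN partial_translationD(2), of x] by simp
  then show "D = E" by (metis ket_nonzero(1) subsetI subset_antisym)
  with *[of x] assms(3) show "d = e" by simp
qed

lemma partial_translation_adj:
  assumes "partial_translation V D d"
  shows "partial_translation (adj V) ((\<lambda>x. x + d) ` D) (- d)"
  unfolding partial_translation_def
proof (intro conjI allI)
  show "adj V (ket y) = (if y \<in> (\<lambda>x. x + d) ` D then ket (y + - d) else 0)" for y
    using partial_translationD[OF assms]
    by (intro ell2_eqI) (auto simp: coord_adj)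
qed (use partial_translationD[OF assms] in simp)

lemma partial_translation_compose:
  assumes "partial_translation V D d" "partial_translation W E e"
  shows "partial_translation (V o\<^sub>L W) {x \<in> E. x + e \<in> D} (e + d)"
  unfolding partial_translation_def
  using partial_translationD[OF assms(1)] partial_translationD[OF assms(2)]
  by (auto simp: add.assoc)

lemma partial_translation_shift: "partial_translation (shift S a) S a"
  by (auto simp: partial_translation_def shift_ket add.commute)

lemma proj_ket: "proj S (ket x) = (if x \<in> S then ket x else 0)"
  by (rule ell2_eqI) (auto simp: proj.rep_eq)

text \<open>The unit of the corner is hence a monomial, and the unit conditions become instances of
  facts about monomials.\<close>

lemma proj_eq_shift: "proj S = shift S (0 :: 'g::ab_group_add)"
  by (rule partial_translation_unique[OF _ partial_translation_shift])
    (simp add: partial_translation_def proj_ket)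

lemma partial_translation_in_bounded_ops:
  assumes V: "partial_translation V D d" and D: "D \<subseteq> S" "(\<lambda>x. x + d) ` D \<subseteq> S"
  shows "V \<in> bounded_ops S"
proof -
  have "proj S o\<^sub>L V = V"
    using partial_translationD[OF V] D by (intro clin_eqI) (auto simp: proj_ket)
  moreover have "V o\<^sub>L proj S = V"
    using partial_translationD[OF V] D by (intro clin_eqI) (auto simp: proj_ket)
  ultimately show ?thesis
    using partial_translationD(1)[OF V] by (simp add: bounded_ops_def clin_def)
qed

locale additive_submonoid =
  fixes S :: "'g::ab_group_add set"
  assumes zero: "0 \<in> S"
    and add_closed: "\<And>a b. a \<in> S \<Longrightarrow> b \<in> S \<Longrightarrow> a + b \<in> S"
begin

abbreviation "M \<equiv> monomials S"

text \<open>
  Domains of monomials contain a translate of \<open>S\<close>, hence are nonempty: this excludes a zero monomial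
  and makes the translation vector unique.
\<close>

lemma monomial_partial_translation:
  assumes V: "V \<in> M"
  shows "\<exists>D d. partial_translation V D d \<and> D \<subseteq> S \<and> (\<lambda>x. x + d) ` D \<subseteq> S \<and> (\<exists>x\<in>S. \<forall>s\<in>S. x + s \<in> D)"
  using V
proof induction
  case (1 a)
  then show ?case
    using zero add_closed
    by (intro exI[of _ S] exI[of _ a]) (auto simp: partial_translation_shift intro!: bexI[of _ 0])
next
  case (2 a)
  then show ?case
    using partial_translation_adj[OF partial_translation_shift, of S a] add_closed
    by (intro exI[of _ "(\<lambda>x. x + a) ` S"] exI[of _ "- a"]) (auto intro!: bexI[of _ a] simp: add.commute)
next
  case (3 V W)
  from 3(3) obtain D d x where V: "partial_translation V D d" "D \<subseteq> S" "(\<lambda>x. x + d) ` D \<subseteq> S"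
    and x: "x \<in> S" "\<And>s. s \<in> S \<Longrightarrow> x + s \<in> D" by blast
  from 3(4) obtain E e y where W: "partial_translation W E e" "E \<subseteq> S" "(\<lambda>x. x + e) ` E \<subseteq> S"
    and y: "y \<in> S" "\<And>s. s \<in> S \<Longrightarrow> y + s \<in> E" by blast
  \<comment> \<open>The witness for the composite is \<open>y + x\<close>: applying \<open>W\<close>
    to \<open>y + x + s\<close> gives \<open>x + ((y + e) + s)\<close>, which lies in the translate
    of \<open>S\<close> inside \<open>D\<close> as soon as \<open>y + e\<close> is in
    \<open>S\<close>.\<close>
  have "y + e \<in> S" using y(2)[OF zero] W(3) by auto
  then have "(y + x + s) + e \<in> D" if "s \<in> S" for s
    using x(2)[OF add_closed[OF \<open>y + e \<in> S\<close> that]] by (simp add: algebra_simps)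
  moreover have "y + x + s \<in> E" if "s \<in> S" for s
    using y(2)[OF add_closed[OF x(1) that]] by (simp add: algebra_simps)
  ultimately have "\<forall>s\<in>S. (y + x) + s \<in> {x \<in> E. x + e \<in> D}" by auto
  moreover have "(\<lambda>x. x + (e + d)) ` {x \<in> E. x + e \<in> D} \<subseteq> S"
    using V(3) by (auto simp: algebra_simps)
  moreover have "{x \<in> E. x + e \<in> D} \<subseteq> S" using W(2) by auto
  ultimately show ?case
    using partial_translation_compose[OF V(1) W(1)] add_closed[OF y(1) x(1)] by blast
qed

lemma monomial_clin: "V \<in> M \<Longrightarrow> clin V"
  using monomial_partial_translation partial_translationD(1) by blast

lemma monomial_nonzero: "V \<in> M \<Longrightarrow> V \<noteq> 0"
proof -
  assume "V \<in> M"
  then obtain D d x where "partial_translation V D d" "x \<in> D"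
    using monomial_partial_translation zero by blast
  then have "V (ket x) \<noteq> 0" by (simp add: partial_translationD)
  then show "V \<noteq> 0" by auto
qed

lemma monomial_in_bounded_ops: "V \<in> M \<Longrightarrow> V \<in> bounded_ops S"
  using monomial_partial_translation partial_translation_in_bounded_ops by blast

lemma monomial_adj: "V \<in> M \<Longrightarrow> adj V \<in> M"
proof (induction rule: monomials.induct)
  case (3 V W)
  then show ?case by (simp add: adj_compose monomial_clin monomials.intros)
qed (auto intro: monomials.intros)

lemma monomials_inverse_semigroup: "inverse_semigroup (M) (o\<^sub>L) adj"
  unfolding inverse_semigroup_def
proof (intro conjI ballI)
  fix V W assume V: "V \<in> M" and W: "W \<in> M"
  obtain D d x where D: "partial_translation V D d" "x \<in> D"
    using monomial_partial_translation[OF V] zero by blast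
  obtain E e y where E: "partial_translation W E e" "y \<in> E"
    using monomial_partial_translation[OF W] zero by blast
  note comp = partial_translation_compose
  note adj' = partial_translation_adj[OF D(1)]
  show "V o\<^sub>L W o\<^sub>L V = V \<and> W o\<^sub>L V o\<^sub>L W = W \<longleftrightarrow> W = adj V"
  proof
    assume "W = adj V"
    moreover have "V o\<^sub>L adj V o\<^sub>L V = V"
      by (rule partial_translation_unique[OF comp[OF comp[OF D(1) adj'] D(1)]])
        (use D(1) in \<open>simp add: partial_translation_def\<close>)
    moreover have "adj V o\<^sub>L V o\<^sub>L adj V = adj V"
      by (rule partial_translation_unique[OF comp[OF comp[OF adj' D(1)] adj']])
        (use adj' in \<open>auto simp: partial_translation_def image_iff\<close>)
    ultimately show "V o\<^sub>L W o\<^sub>L V = V \<and> W o\<^sub>L V o\<^sub>L W = W" by simp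
  next
    assume *: "V o\<^sub>L W o\<^sub>L V = V \<and> W o\<^sub>L V o\<^sub>L W = W"
    \<comment> \<open>Comparing vectors in this equation gives \<open>e = - d\<close>; comparing
      domains shows that \<open>D\<close> is carried into \<open>E\<close>. The second equation
      gives the reverse inclusion, so \<open>W\<close> has the data of \<open>adj V\<close>.\<close>
    have "partial_translation V {x \<in> D. x + d \<in> {x \<in> E. x + e \<in> D}} (d + (e + d))"
      using comp[OF comp[OF D(1) E(1)] D(1)] * by simp
    from partial_translation_determined[OF D(1) this D(2)]
    have e: "e = - d" and DE: "\<And>x. x \<in> D \<Longrightarrow> x + d \<in> E"
      by (auto simp: add_eq_0_iff)
    have "partial_translation W {x \<in> E. x + e \<in> {x \<in> D. x + d \<in> E}} (e + (d + e))"
      using comp[OF comp[OF E(1) D(1)] E(1)] * by simp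
    from partial_translation_determined(1)[OF E(1) this E(2)]
    have "\<And>x. x \<in> E \<Longrightarrow> x - d \<in> D" by (auto simp: e)
    then have "E = (\<lambda>x. x + d) ` D"
      using DE by (force simp: image_iff)
    then show "W = adj V"
      using partial_translation_unique[OF E(1)] adj' e by simp
  qed
qed (auto intro: monomials.intros monomial_adj intro!: blinfun_eqI)

end

section \<open>The weak Hopf algebra of an inverse semigroup\<close>

lemma lookup_smul [simp]: "Poly_Mapping.lookup (smul c x) u = c * Poly_Mapping.lookup x u"
  by (simp add: smul_def map.rep_eq when_def)

lemma smul_simps [simp]:
  "smul c (x + y) = smul c x + smul c y"
  "smul c (smul d x) = smul (c * d) x"
  "smul c 0 = 0" "smul 0 x = 0" "smul 1 x = x"
  by (auto intro!: poly_mapping_eqI simp: lookup_add algebra_simps)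

lemma smul_add_left: "smul (c + d) x = smul c x + smul d x"
  by (auto intro!: poly_mapping_eqI simp: lookup_add algebra_simps)

lemma smul_sum: "smul c (sum f I) = (\<Sum>i\<in>I. smul c (f i))"
  by (induction I rule: infinite_finite_induct) auto

lemma keys_smul_subset: "Poly_Mapping.keys (smul c x) \<subseteq> Poly_Mapping.keys x"
  by (auto simp: in_keys_iff)

text \<open>Multiplying by zero empties the support, so the sum is compared over the support of
  \<open>x\<close>, where the additional terms vanish.\<close>

lemma sum_keys_smul:
  assumes "\<And>u. f u 0 = 0"
  shows "(\<Sum>u\<in>Poly_Mapping.keys (smul c x). f u (Poly_Mapping.lookup (smul c x) u)) =
    (\<Sum>u\<in>Poly_Mapping.keys x. f u (c * Poly_Mapping.lookup x u))"
  using keys_smul_subset[of c x]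
  by (intro sum.mono_neutral_cong_left) (auto simp: in_keys_iff assms)

lemma free_space_simps [simp]:
  "0 \<in> free_space M"
  "x \<in> free_space M \<Longrightarrow> y \<in> free_space M \<Longrightarrow> x + y \<in> free_space M"
  "x \<in> free_space M \<Longrightarrow> smul c x \<in> free_space M"
  "basis u \<in> free_space M \<longleftrightarrow> u \<in> M"
  using keys_add[of x y] keys_smul_subset[of c x] by (auto simp: free_space_def)

lemma free_space_induct [consumes 1, case_names zero add basis]:
  assumes x: "x \<in> free_space M"
    and zero: "P 0" and add: "\<And>x y. x \<in> free_space M \<Longrightarrow> y \<in> free_space M \<Longrightarrow> P x \<Longrightarrow> P y \<Longrightarrow> P (x + y)"
    and basis: "\<And>c u. u \<in> M \<Longrightarrow> P (smul c (basis u))"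
  shows "P x"
proof -
  have eq: "x = (\<Sum>u\<in>Poly_Mapping.keys x. smul (Poly_Mapping.lookup x u) (basis u))"
    by (rule poly_mapping_eqI)
      (simp add: lookup_sum lookup_single when_def in_keys_iff if_distrib cong: if_cong)
  have "(\<Sum>u\<in>F. smul (Poly_Mapping.lookup x u) (basis u)) \<in> free_space M \<and>
      P (\<Sum>u\<in>F. smul (Poly_Mapping.lookup x u) (basis u))" if "finite F" "F \<subseteq> M" for F
    using that by (induction F) (auto intro!: zero add basis)
  from this[of "Poly_Mapping.keys x"] show ?thesis
    using x by (simp add: free_space_def flip: eq)
qed

text \<open>The structure maps are linear on all finitely supported functions. Support in
  \<open>M\<close> then matters only when an identity is evaluated on basis elements.\<close>

abbreviation lin :: "(('m \<Rightarrow>\<^sub>0 complex) \<Rightarrow> ('n \<Rightarrow>\<^sub>0 complex)) \<Rightarrow> bool" where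
  "lin \<equiv> linear_on_free UNIV UNIV"

lemma lin_def: "lin p \<longleftrightarrow> (\<forall>x y. p (x + y) = p x + p y) \<and> (\<forall>c x. p (smul c x) = smul c (p x))"
  by (auto simp: linear_on_free_def free_space_def)

lemma lin_zero: "lin p \<Longrightarrow> p 0 = 0"
  unfolding lin_def by (metis smul_simps(4))

lemma lin_lin_ext: "lin (lin_ext p)"
  unfolding lin_def lin_ext_def
proof (intro conjI allI)
  fix x y c
  show "(\<Sum>u\<in>Poly_Mapping.keys (x + y). smul (Poly_Mapping.lookup (x + y) u) (p u)) =
      (\<Sum>u\<in>Poly_Mapping.keys x. smul (Poly_Mapping.lookup x u) (p u)) +
      (\<Sum>u\<in>Poly_Mapping.keys y. smul (Poly_Mapping.lookup y u) (p u))"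
    by (rule setsum_keys_plus_distrib) (auto simp: smul_add_left)
  show "(\<Sum>u\<in>Poly_Mapping.keys (smul c x). smul (Poly_Mapping.lookup (smul c x) u) (p u)) =
      smul c (\<Sum>u\<in>Poly_Mapping.keys x. smul (Poly_Mapping.lookup x u) (p u))"
    by (subst sum_keys_smul[where f = "\<lambda>u d. smul d (p u)"]) (auto simp: smul_sum)
qed

text \<open>For the inner argument of bilinear maps given by nested extensions;
  \<open>lin_lin_ext\<close> handles the outer one.\<close>

lemma lin_lin_ext_parameter:
  assumes "\<And>u. lin (\<lambda>y. P u y)"
  shows "lin (\<lambda>y. lin_ext (\<lambda>u. P u y) x)"
  using assms unfolding lin_def lin_ext_def
  by (auto simp: sum.distrib smul_sum mult.commute)

lemma lin_id: "lin (\<lambda>x. x)"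
  by (simp add: lin_def)

lemma lin_compose: "lin p \<Longrightarrow> lin q \<Longrightarrow> lin (\<lambda>x. p (q x))"
  by (simp add: lin_def)

lemma lin_ext_basis [simp]: "lin_ext p (basis u) = p u"
  by (simp add: lin_ext_def)

lemma lin_eqI:
  assumes "x \<in> free_space M" "lin p" "lin q" "\<And>u. u \<in> M \<Longrightarrow> p (basis u) = q (basis u)"
  shows "p x = q x"
  using assms(1)
proof (induction rule: free_space_induct)
  case (add x y)
  then show ?case using assms(2,3) unfolding lin_def by metis
next
  case (basis c u)
  then show ?case using assms(2-4) unfolding lin_def by metis
qed (simp add: lin_zero assms)

lemma lin_image:
  assumes "lin p" "\<And>u. u \<in> M \<Longrightarrow> p (basis u) \<in> free_space N" "x \<in> free_space M"
  shows "p x \<in> free_space N"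
  using assms(3)
proof (induction rule: free_space_induct)
  case (add x y)
  moreover have "p (x + y) = p x + p y" using assms(1) unfolding lin_def by blast
  ultimately show ?case by simp
next
  case (basis c u)
  moreover have "p (smul c (basis u)) = smul c (p (basis u))" using assms(1) unfolding lin_def by blast
  ultimately show ?case using assms(2) by simp
qed (simp add: lin_zero assms)

lemma linear_on_freeI:
  "lin p \<Longrightarrow> (\<And>u. u \<in> M \<Longrightarrow> p (basis u) \<in> free_space N) \<Longrightarrow> linear_on_free M N p"
  using lin_image[of p M N] unfolding lin_def by (auto simp: linear_on_free_def)

lemma lin_structure_maps:
  "lin (sa_mult mul x)" "lin (\<lambda>x. sa_mult mul x y)" "lin sa_comult" "lin (sa_antipode star)"
  "lin (tensor_map p q)" "lin tensor_assoc" "lin (triple_mult \<mu>)"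
  "lin (tensor_mult \<mu>' s)" "lin (\<lambda>s. tensor_mult \<mu>' s t)"
  unfolding sa_mult_def [abs_def] tensor_mult_def [abs_def]
  by (auto simp: sa_comult_def sa_antipode_def tensor_map_def tensor_assoc_def
      triple_mult_def case_prod_unfold intro!: lin_lin_ext lin_lin_ext_parameter)

lemmas lin_intros = lin_id lin_structure_maps lin_structure_maps[THEN lin_compose]

lemma structure_maps_basis [simp]:
  "sa_mult mul (basis u) (basis v) = basis (mul u v)"
  "sa_comult (basis a) = basis (a, a)"
  "sa_antipode star (basis b) = basis (star b)"
  "tensor (basis c) (basis d) = basis (c, d)"
  "tensor_map p q (basis (e, f)) = tensor (p (basis e)) (q (basis f))"
  "tensor_assoc (basis ((g, h), i)) = basis (g, h, i)"
  "triple_mult \<mu> (basis ((j, k), l)) = \<mu> (\<mu> (basis j) (basis k)) (basis l)"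
  "tensor_mult \<mu>' (basis (m, n)) (basis (m', n')) =
    tensor (\<mu>' (basis m) (basis m')) (\<mu>' (basis n) (basis n'))"
  by (simp_all add: sa_mult_def sa_comult_def sa_antipode_def tensor_def tensor_map_def tensor_assoc_def
      triple_mult_def tensor_mult_def)

text \<open>All identities are multilinear, so they need only be checked on basis elements.\<close>

lemma weak_hopf_semigroup_algebra:
  assumes M: "inverse_semigroup M mul star"
  shows "weak_hopf_algebra M (sa_mult mul) sa_comult (sa_antipode star)"
  unfolding weak_hopf_algebra_def
proof (intro conjI ballI)
  let ?\<mu> = "sa_mult mul"
  have mul: "u \<in> M \<Longrightarrow> v \<in> M \<Longrightarrow> mul u v \<in> M" for u v
    using M by (simp add: inverse_semigroup_def)
  have assoc: "u \<in> M \<Longrightarrow> v \<in> M \<Longrightarrow> w \<in> M \<Longrightarrow> mul (mul u v) w = mul u (mul v w)" for u v w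
    using M by (simp add: inverse_semigroup_def)
  have star: "u \<in> M \<Longrightarrow> star u \<in> M" "u \<in> M \<Longrightarrow> mul (mul u (star u)) u = u"
    "u \<in> M \<Longrightarrow> mul (mul (star u) u) (star u) = star u" for u
    using M unfolding inverse_semigroup_def by blast+
  show "assoc_algebra M ?\<mu>"
    unfolding assoc_algebra_def
  proof (intro conjI ballI)
    fix x assume x: "x \<in> free_space M"
    show "linear_on_free M M (?\<mu> x)"
      by (rule linear_on_freeI)
        (auto intro!: lin_structure_maps lin_image[of "\<lambda>x. ?\<mu> x _", OF _ _ x] simp: mul)
    show "linear_on_free M M (\<lambda>y. ?\<mu> y x)"
      by (rule linear_on_freeI)
        (auto intro!: lin_structure_maps lin_image[of "?\<mu> _", OF _ _ x] simp: mul)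
    fix y z assume y: "y \<in> free_space M" and z: "z \<in> free_space M"
    show "?\<mu> (?\<mu> x y) z = ?\<mu> x (?\<mu> y z)"
    proof (rule lin_eqI[of x M "\<lambda>x. ?\<mu> (?\<mu> x y) z" "\<lambda>x. ?\<mu> x (?\<mu> y z)", OF x])
      fix u assume u: "u \<in> M"
      show "?\<mu> (?\<mu> (basis u) y) z = ?\<mu> (basis u) (?\<mu> y z)"
      proof (rule lin_eqI[of y M "\<lambda>y. ?\<mu> (?\<mu> (basis u) y) z" "\<lambda>y. ?\<mu> (basis u) (?\<mu> y z)", OF y])
        fix v assume v: "v \<in> M"
        show "?\<mu> (?\<mu> (basis u) (basis v)) z = ?\<mu> (basis u) (?\<mu> (basis v) z)"
          by (rule lin_eqI[of z M "\<lambda>z. ?\<mu> (?\<mu> (basis u) (basis v)) z"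
                "\<lambda>z. ?\<mu> (basis u) (?\<mu> (basis v) z)", OF z])
            (auto intro: lin_intros simp: assoc u v)
      qed (intro lin_intros)+
    qed (intro lin_intros)+
  qed
  show "comultiplication M ?\<mu> sa_comult"
    unfolding comultiplication_def
  proof (intro conjI ballI)
    show "linear_on_free M (M \<times> M) sa_comult"
      by (rule linear_on_freeI) (auto intro: lin_structure_maps)
    fix x assume x: "x \<in> free_space M"
    show "tensor_assoc (tensor_map sa_comult id (sa_comult x)) = tensor_map id sa_comult (sa_comult x)"
      by (rule lin_eqI[of x M "\<lambda>x. tensor_assoc (tensor_map sa_comult id (sa_comult x))"
            "\<lambda>x. tensor_map id sa_comult (sa_comult x)", OF x])
        (auto intro!: lin_intros)
    fix y assume y: "y \<in> free_space M"
    show "sa_comult (?\<mu> x y) = tensor_mult ?\<mu> (sa_comult x) (sa_comult y)"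
    proof (rule lin_eqI[of x M "\<lambda>x. sa_comult (?\<mu> x y)"
          "\<lambda>x. tensor_mult ?\<mu> (sa_comult x) (sa_comult y)", OF x])
      fix u
      show "sa_comult (?\<mu> (basis u) y) = tensor_mult ?\<mu> (sa_comult (basis u)) (sa_comult y)"
        by (rule lin_eqI[of y M "\<lambda>y. sa_comult (?\<mu> (basis u) y)"
              "\<lambda>y. tensor_mult ?\<mu> (sa_comult (basis u)) (sa_comult y)", OF y])
          (auto intro!: lin_intros)
    qed (intro lin_intros)+
  qed
  show "linear_on_free M M (sa_antipode star)"
    by (rule linear_on_freeI) (auto intro: lin_structure_maps simp: star)
  fix x assume x: "x \<in> free_space M"
  \<comment> \<open>On a basis element \<open>u\<close> the two antipode conditions are the
    inverse-semigroup equations for \<open>u\<close> and \<open>star u\<close>.\<close>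
  show "triple_mult ?\<mu> (tensor_map (tensor_map id (sa_antipode star)) id
      (tensor_map sa_comult id (sa_comult x))) = x"
    by (rule lin_eqI[of x M "\<lambda>x. triple_mult ?\<mu> (tensor_map (tensor_map id (sa_antipode star)) id
            (tensor_map sa_comult id (sa_comult x)))" "\<lambda>x. x", OF x])
      (auto intro!: lin_intros simp: star)
  show "triple_mult ?\<mu> (tensor_map (tensor_map (sa_antipode star) id) (sa_antipode star)
      (tensor_map sa_comult id (sa_comult x))) = sa_antipode star x"
    by (rule lin_eqI[of x M "\<lambda>x. triple_mult ?\<mu> (tensor_map (tensor_map (sa_antipode star) id)
            (sa_antipode star) (tensor_map sa_comult id (sa_comult x)))" "sa_antipode star", OF x])
      (auto intro!: lin_intros simp: star)
qed

section \<open>Realization of formal combinations as operators\<close>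

lemma realize_simps [simp]:
  "realize (x + y) = realize x + realize y"
  "realize (smul c x) = cmul c (realize x)"
  "realize (basis V) = V" "realize 0 = 0"
proof -
  show "realize (x + y) = realize x + realize y"
    unfolding realize_def by (rule setsum_keys_plus_distrib) (auto simp: cmul_add_left)
  show "realize (smul c x) = cmul c (realize x)"
    unfolding realize_def
    by (subst sum_keys_smul[where f = "\<lambda>V d. cmul d V"]) (auto simp: cmul_sum)
qed (auto simp: realize_def)

lemma realize2_simps [simp]:
  "realize2 (s + t) = realize2 s + realize2 t"
  "realize2 (smul c s) = cmul c (realize2 s)"
  "realize2 (basis (V, W)) = op_tensor V W" "realize2 0 = 0"
proof -
  show "realize2 (s + t) = realize2 s + realize2 t"
    unfolding realize2_def case_prod_unfold prod.collapse
    by (rule setsum_keys_plus_distrib) (auto simp: cmul_add_left)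
  show "realize2 (smul c s) = cmul c (realize2 s)"
    unfolding realize2_def case_prod_unfold prod.collapse
    by (subst sum_keys_smul[where f = "\<lambda>p d. cmul d (op_tensor (fst p) (snd p))"]) (auto simp: cmul_sum)
qed (auto simp: realize2_def)

section \<open>The comultiplication of the reduced algebra\<close>

lemma bounded_ops_clin: "T \<in> bounded_ops X \<Longrightarrow> clin T"
  by (simp add: bounded_ops_def clin_def)

lemma in_bounded_ops_iff: "T \<in> bounded_ops X \<longleftrightarrow> proj X o\<^sub>L T = T \<and> T o\<^sub>L proj X = T \<and> clin T"
  by (simp add: bounded_ops_def clin_def)

lemma cstar_subalgebra_bounded_ops: "cstar_subalgebra X (bounded_ops X)"
  unfolding cstar_subalgebra_def
proof (intro conjI ballI allI)
  fix T R assume T: "T \<in> bounded_ops X" and R: "R \<in> bounded_ops X"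
  show "T + R \<in> bounded_ops X"
    using T R by (auto simp: in_bounded_ops_iff blinfun_compose_simps)
  have "proj X o\<^sub>L (T o\<^sub>L R) = (proj X o\<^sub>L T) o\<^sub>L R" "(T o\<^sub>L R) o\<^sub>L proj X = T o\<^sub>L (R o\<^sub>L proj X)"
    by (auto intro!: blinfun_eqI)
  then show "T o\<^sub>L R \<in> bounded_ops X"
    using T R by (auto simp: in_bounded_ops_iff)
next
  fix T assume T: "T \<in> bounded_ops X"
  show "cmul c T \<in> bounded_ops X" for c
    using T by (auto simp: in_bounded_ops_iff)
  have T': "proj X o\<^sub>L T = T" "T o\<^sub>L proj X = T" "clin T"
    using T by (auto simp: in_bounded_ops_iff)
  \<comment> \<open>Taking adjoints interchanges the left and the right corner condition.\<close>
  have "adj (T o\<^sub>L proj X) = adj (proj X) o\<^sub>L adj T" "adj (proj X o\<^sub>L T) = adj T o\<^sub>L adj (proj X)"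
    by (intro adj_compose T' clin_simps)+
  then show "adj T \<in> bounded_ops X"
    using T'(3) by (simp add: in_bounded_ops_iff T'(1,2))
next
  have "bounded_ops X = {T. proj X o\<^sub>L T = T} \<inter> {T. T o\<^sub>L proj X = T} \<inter> {T. clin T}"
    by (auto simp: in_bounded_ops_iff)
  then show "closed (bounded_ops X)"
    by (simp only:) (intro closed_Int closed_clin closed_Collect_eq continuous_intros)
qed (auto simp: in_bounded_ops_iff)

lemma cstar_subalgebra_closure:
  assumes C: "C \<subseteq> bounded_ops X" "0 \<in> C" "\<And>T R. T \<in> C \<Longrightarrow> R \<in> C \<Longrightarrow> T + R \<in> C"
    "\<And>T R. T \<in> C \<Longrightarrow> R \<in> C \<Longrightarrow> T o\<^sub>L R \<in> C" "\<And>c T. T \<in> C \<Longrightarrow> cmul c T \<in> C"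
    "\<And>T. T \<in> C \<Longrightarrow> adj T \<in> C"
  shows "cstar_subalgebra X (closure C)"
proof -
  have sub: "closure C \<subseteq> bounded_ops X"
    using cstar_subalgebra_bounded_ops[of X] C(1) by (intro closure_minimal) (auto simp: cstar_subalgebra_def)
  have cl: "clin T" if "T \<in> closure C" for T
    using sub that bounded_ops_clin by blast
  have seq: "\<exists>t. (\<forall>n. t n \<in> C \<and> clin (t n)) \<and> t \<longlonglongrightarrow> T" if T: "T \<in> closure C" for T
  proof -
    obtain t where "\<And>n. t n \<in> C" "t \<longlonglongrightarrow> T" using T unfolding closure_sequential by blast
    then show ?thesis using C(1) bounded_ops_clin by blast
  qed
  show ?thesis
    unfolding cstar_subalgebra_def
  proof (intro conjI ballI allI)
    show "0 \<in> closure C" using C(2) closure_subset by blast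
    fix T R assume T: "T \<in> closure C" and R: "R \<in> closure C"
    obtain t r where t: "\<And>n. t n \<in> C" "t \<longlonglongrightarrow> T" and r: "\<And>n. r n \<in> C" "r \<longlonglongrightarrow> R"
      using seq[OF T] seq[OF R] by auto
    show "T + R \<in> closure C"
      unfolding closure_sequential
      by (intro exI[of _ "\<lambda>n. t n + r n"]) (auto intro: C t r tendsto_add)
    show "T o\<^sub>L R \<in> closure C"
      unfolding closure_sequential
      by (intro exI[of _ "\<lambda>n. t n o\<^sub>L r n"]) (auto intro: C t r tendsto_intros)
  next
    fix T assume T: "T \<in> closure C"
    obtain t where t: "\<And>n. t n \<in> C" "\<And>n. clin (t n)" "t \<longlonglongrightarrow> T"
      using seq[OF T] by auto
    show "cmul c T \<in> closure C" for c
      unfolding closure_sequential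
      by (intro exI[of _ "\<lambda>n. cmul c (t n)"])
        (auto intro: C t bounded_linear.tendsto[OF bounded_linear_cmul])
    show "adj T \<in> closure C"
      unfolding closure_sequential
      by (intro exI[of _ "\<lambda>n. adj (t n)"]) (auto intro!: C t tendsto_adj cl T)
  qed (use sub in auto)
qed

lemma realize2_sum: "realize2 (\<Sum>i\<in>I. f i) = (\<Sum>i\<in>I. realize2 (f i))"
  by (induction I rule: infinite_finite_induct) auto

locale comultiplication_on_monomials = additive_submonoid S
  for S :: "'g::ab_group_add set" +
  fixes \<Delta> :: "'g op \<Rightarrow> ('g \<times> 'g) op"
  assumes \<Delta>_continuous: "continuous_on (reduced_cstar S) \<Delta>"
    and \<Delta>_combinations: "\<And>(F :: 'g op set) (c :: 'g op \<Rightarrow> complex).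
      finite F \<Longrightarrow> F \<subseteq> monomials S \<Longrightarrow>
      \<Delta> (\<Sum>V\<in>F. cmul (c V) V) = (\<Sum>V\<in>F. cmul (c V) (op_tensor V V))"
begin

abbreviation "A \<equiv> reduced_cstar S"
abbreviation "combinations \<equiv> realize ` free_space M"

lemma realize_in_cstar_subalgebra:
  assumes "x \<in> free_space M" "cstar_subalgebra S B" "M \<subseteq> B"
  shows "realize x \<in> B"
  using assms(1) by (induction rule: free_space_induct) (use assms(2,3) in \<open>auto simp: cstar_subalgebra_def\<close>)

lemma realize_bounded_ops: "x \<in> free_space M \<Longrightarrow> realize x \<in> bounded_ops S"
  using realize_in_cstar_subalgebra[OF _ cstar_subalgebra_bounded_ops] monomial_in_bounded_ops by blast

lemma realize_mult:
  assumes x: "x \<in> free_space M" and y: "y \<in> free_space M"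
  shows "realize (sa_mult (o\<^sub>L) x y) = realize x o\<^sub>L realize y"
proof -
  have L: "sa_mult (o\<^sub>L) (x + x') y = sa_mult (o\<^sub>L) x y + sa_mult (o\<^sub>L) x' y"
    "sa_mult (o\<^sub>L) (smul c x) y = smul c (sa_mult (o\<^sub>L) x y)"
    "sa_mult (o\<^sub>L) y (x + x') = sa_mult (o\<^sub>L) y x + sa_mult (o\<^sub>L) y x'"
    "sa_mult (o\<^sub>L) y (smul c x) = smul c (sa_mult (o\<^sub>L) y x)"
    "sa_mult (o\<^sub>L) 0 y = 0" "sa_mult (o\<^sub>L) y 0 = 0" for x x' y c
    using lin_structure_maps(2)[of "(o\<^sub>L)" y] lin_structure_maps(1)[of "(o\<^sub>L)" y]
      lin_zero[OF lin_structure_maps(1)] lin_zero[OF lin_structure_maps(2)]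
    by (auto simp: lin_def)
  have one: "realize (sa_mult (o\<^sub>L) (basis V) y) = V o\<^sub>L realize y" if "V \<in> M" for V
    using y that by (induction rule: free_space_induct) (auto simp: L blinfun_compose_simps monomial_clin)
  show ?thesis
    using x by (induction rule: free_space_induct) (auto simp: L blinfun_compose_simps one)
qed

lemma adj_realize: "x \<in> free_space M \<Longrightarrow> adj (realize x) \<in> combinations"
proof (induction rule: free_space_induct)
  case zero
  then show ?case by (auto intro!: image_eqI[of _ _ 0])
next
  case (add x y)
  then obtain x' y' where "x' \<in> free_space M" "y' \<in> free_space M"
    "adj (realize x) = realize x'" "adj (realize y) = realize y'" by blast
  then show ?case
    using add(1,2)[THEN realize_bounded_ops, THEN bounded_ops_clin]
    by (intro image_eqI[of _ _ "x' + y'"]) (auto simp: adj_add)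
next
  case (basis c V)
  then show ?case
    by (intro image_eqI[of _ _ "smul (cnj c) (basis (adj V))"]) (auto simp: adj_cmul monomial_clin monomial_adj)
qed

text \<open>The closure of the combinations is a \<open>C*\<close>-subalgebra containing the
  generators, and any other such subalgebra contains the monomials and hence this closure. That the
  hull is itself a \<open>C*\<close>-subalgebra is then read off from the equality.\<close>

lemma A_eq_closure: "A = closure combinations" and cstar_A: "cstar_subalgebra S A"
proof -
  have cstar: "cstar_subalgebra S (closure combinations)"
  proof (rule cstar_subalgebra_closure)
    show "combinations \<subseteq> bounded_ops S" using realize_bounded_ops by blast
    show "0 \<in> combinations" by (auto intro!: image_eqI[of _ _ 0])
  next
    fix T R assume "T \<in> combinations" "R \<in> combinations"
    then obtain x y where xy: "x \<in> free_space M" "y \<in> free_space M" "T = realize x" "R = realize y"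
      by blast
    then show "T + R \<in> combinations" by (auto intro!: image_eqI[of _ _ "x + y"])
    have "linear_on_free M M (sa_mult (o\<^sub>L) x)"
      using weak_hopf_semigroup_algebra[OF monomials_inverse_semigroup] xy(1)
      by (simp add: weak_hopf_algebra_def assoc_algebra_def)
    then show "T o\<^sub>L R \<in> combinations"
      using xy by (intro image_eqI[of _ _ "sa_mult (o\<^sub>L) x y"]) (auto simp: realize_mult linear_on_free_def)
  next
    fix T c assume "T \<in> combinations"
    then obtain x where x: "x \<in> free_space M" "T = realize x" by blast
    then show "cmul c T \<in> combinations" by (auto intro!: image_eqI[of _ _ "smul c x"])
    show "adj T \<in> combinations" using x adj_realize by simp
  qed
  have gens: "(\<Union>a\<in>S. {shift S a, adj (shift S a)}) \<subseteq> closure combinations"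
  proof -
    have "V \<in> combinations" if "V \<in> M" for V
      using that by (intro image_eqI[of _ _ "basis V"]) auto
    then show ?thesis using closure_subset[of combinations] by (blast intro: monomials.intros)
  qed
  have "A \<subseteq> closure combinations"
    unfolding reduced_cstar_def using gens cstar by (rule hull_minimal)
  moreover have "closure combinations \<subseteq> A"
    unfolding reduced_cstar_def hull_def
  proof (intro Inter_greatest closure_minimal)
    fix B assume "B \<in> {B. cstar_subalgebra S B \<and> (\<Union>a\<in>S. {shift S a, adj (shift S a)}) \<subseteq> B}"
    then have B: "cstar_subalgebra S B" and gen: "(\<Union>a\<in>S. {shift S a, adj (shift S a)}) \<subseteq> B" by auto
    show "closed B" using B by (simp add: cstar_subalgebra_def)
    have "V \<in> B" if "V \<in> M" for V
      using that by induction (use B gen in \<open>auto simp: cstar_subalgebra_def\<close>)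
    then have "realize x \<in> B" if "x \<in> free_space M" for x
      using that B by (intro realize_in_cstar_subalgebra) auto
    then show "combinations \<subseteq> B" by blast
  qed
  ultimately show "A = closure combinations" by (rule subset_antisym)
  with cstar show "cstar_subalgebra S A" by simp
qed

lemma A_simps:
  "T \<in> A \<Longrightarrow> clin T" "0 \<in> A"
  "T \<in> A \<Longrightarrow> R \<in> A \<Longrightarrow> T + R \<in> A" "T \<in> A \<Longrightarrow> R \<in> A \<Longrightarrow> T o\<^sub>L R \<in> A"
  "T \<in> A \<Longrightarrow> cmul c T \<in> A" "T \<in> A \<Longrightarrow> adj T \<in> A" "x \<in> free_space M \<Longrightarrow> realize x \<in> A"
  using cstar_A closure_subset[of combinations] bounded_ops_clin[of T S]
  by (auto simp: cstar_subalgebra_def A_eq_closure[symmetric])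

lemma M_in_A: "V \<in> M \<Longrightarrow> V \<in> A"
  using A_simps(7)[of "basis V"] by simp

lemma tendsto_\<Delta>:
  assumes "\<And>n. t n \<in> A" "T \<in> A" "t \<longlonglongrightarrow> T"
  shows "(\<lambda>n. \<Delta> (t n)) \<longlonglongrightarrow> \<Delta> T"
  by (rule continuous_on_tendsto_compose[OF \<Delta>_continuous assms(3,2)]) (simp add: assms(1))

lemma A_sequence:
  assumes "T \<in> A"
  obtains x where "\<And>n. x n \<in> free_space M" "(\<lambda>n. realize (x n)) \<longlonglongrightarrow> T"
proof -
  from assms obtain t where t: "\<And>n. t n \<in> combinations" "t \<longlonglongrightarrow> T"
    unfolding A_eq_closure closure_sequential by blast
  then have "\<forall>n. \<exists>x. x \<in> free_space M \<and> t n = realize x" by blast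
  then obtain x where x: "\<And>n. x n \<in> free_space M" "\<And>n. t n = realize (x n)" by metis
  then have "t = (\<lambda>n. realize (x n))" by blast
  with t(2) x(1) show ?thesis by (intro that[of x]) auto
qed

lemma A_induct [consumes 1, case_names monomial add scale limit]:
  assumes T: "T \<in> A"
    and mono: "\<And>V. V \<in> M \<Longrightarrow> P V"
    and add: "\<And>T R. T \<in> A \<Longrightarrow> R \<in> A \<Longrightarrow> P T \<Longrightarrow> P R \<Longrightarrow> P (T + R)"
    and scale: "\<And>c T. T \<in> A \<Longrightarrow> P T \<Longrightarrow> P (cmul c T)"
    and limit: "\<And>t T. (\<And>n. t n \<in> A) \<Longrightarrow> (\<And>n. P (t n)) \<Longrightarrow> T \<in> A \<Longrightarrow> t \<longlonglongrightarrow> T \<Longrightarrow> P T"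
  shows "P T"
proof -
  have M0: "shift S 0 \<in> M" using zero by (rule monomials.intros)
  have P: "P (realize x)" if "x \<in> free_space M" for x
    using that
  proof (induction rule: free_space_induct)
    case zero
    \<comment> \<open>Zero is the multiple by 0 of the monomial \<open>shift S 0\<close>, so the
      induction rule needs no case for it.\<close>
    show ?case using scale[OF M_in_A[OF M0] mono[OF M0], of 0] by simp
  qed (auto intro: add scale mono A_simps M_in_A)
  obtain x where x: "\<And>n. x n \<in> free_space M" "(\<lambda>n. realize (x n)) \<longlonglongrightarrow> T"
    using A_sequence[OF T] by blast
  show ?thesis by (rule limit[OF A_simps(7)[OF x(1)] P[OF x(1)] T x(2)])
qed

lemma \<Delta>_realize:
  assumes "x \<in> free_space M"
  shows "\<Delta> (realize x) = realize2 (sa_comult x)"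
  using \<Delta>_combinations[of "Poly_Mapping.keys x" "Poly_Mapping.lookup x"] assms
  by (simp add: realize_def sa_comult_def lin_ext_def realize2_sum free_space_def)

lemma \<Delta>_monomial: "V \<in> M \<Longrightarrow> \<Delta> V = op_tensor V V"
  using \<Delta>_combinations[of "{V}" "\<lambda>_. 1"] by simp

text \<open>Two combinations may involve different sets of monomials. Adding them in the free space
  merges the supports, and linearity of \<open>sa_comult\<close> does the bookkeeping.\<close>

lemma \<Delta>_add:
  assumes T: "T \<in> A" and R: "R \<in> A"
  shows "\<Delta> (T + R) = \<Delta> T + \<Delta> R"
proof -
  obtain x where x: "\<And>n. x n \<in> free_space M" "(\<lambda>n. realize (x n)) \<longlonglongrightarrow> T"
    using A_sequence[OF T] by blast
  obtain y where y: "\<And>n. y n \<in> free_space M" "(\<lambda>n. realize (y n)) \<longlonglongrightarrow> R"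
    using A_sequence[OF R] by blast
  have "\<Delta> (realize (x n) + realize (y n)) = \<Delta> (realize (x n)) + \<Delta> (realize (y n))" for n
  proof -
    have "\<Delta> (realize (x n + y n)) = realize2 (sa_comult (x n + y n))"
      using x(1) y(1) by (intro \<Delta>_realize free_space_simps)
    also have "sa_comult (x n + y n) = sa_comult (x n) + sa_comult (y n)"
      using lin_structure_maps(3) unfolding lin_def by blast
    finally show ?thesis by (simp add: \<Delta>_realize x(1) y(1))
  qed
  moreover have "(\<lambda>n. \<Delta> (realize (x n) + realize (y n))) \<longlonglongrightarrow> \<Delta> (T + R)"
    by (intro tendsto_\<Delta> A_simps x y T R tendsto_add)
  moreover have "(\<lambda>n. \<Delta> (realize (x n)) + \<Delta> (realize (y n))) \<longlonglongrightarrow> \<Delta> T + \<Delta> R"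
    by (intro tendsto_\<Delta> A_simps x y T R tendsto_add)
  ultimately show ?thesis using LIMSEQ_unique by simp
qed

lemma \<Delta>_cmul:
  assumes T: "T \<in> A"
  shows "\<Delta> (cmul c T) = cmul c (\<Delta> T)"
proof -
  obtain x where x: "\<And>n. x n \<in> free_space M" "(\<lambda>n. realize (x n)) \<longlonglongrightarrow> T"
    using A_sequence[OF T] by blast
  have "\<Delta> (cmul c (realize (x n))) = cmul c (\<Delta> (realize (x n)))" for n
  proof -
    have "\<Delta> (realize (smul c (x n))) = realize2 (sa_comult (smul c (x n)))"
      using x(1) by (intro \<Delta>_realize free_space_simps)
    also have "sa_comult (smul c (x n)) = smul c (sa_comult (x n))"
      using lin_structure_maps(3) unfolding lin_def by blast
    finally show ?thesis by (simp add: \<Delta>_realize x(1))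
  qed
  moreover have "(\<lambda>n. \<Delta> (cmul c (realize (x n)))) \<longlonglongrightarrow> \<Delta> (cmul c T)"
    by (intro tendsto_\<Delta> A_simps x T bounded_linear.tendsto[OF bounded_linear_cmul])
  moreover have "(\<lambda>n. cmul c (\<Delta> (realize (x n)))) \<longlonglongrightarrow> cmul c (\<Delta> T)"
    by (intro tendsto_\<Delta> A_simps x T bounded_linear.tendsto[OF bounded_linear_cmul])
  ultimately show ?thesis using LIMSEQ_unique by simp
qed

lemma min_tensor_clin:
  assumes "X \<in> min_tensor A A"
  shows "clin X"
  using assms
proof (induction rule: min_tensor_induct)
  case (scale r X)
  then show ?case using clin_simps(1)[of X "of_real r"] by (simp add: cmul_of_real)
qed (auto simp: A_simps closed_clin)

text \<open>Although the span is over the reals, a complex scalar can be absorbed into the first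
  factor of an elementary tensor.\<close>

lemma min_tensor_cmul: "X \<in> min_tensor A A \<Longrightarrow> cmul c X \<in> min_tensor A A"
proof (induction rule: min_tensor_induct)
  case (tensor T R)
  then show ?case
    by (simp add: A_simps op_tensor_in_min_tensor flip: op_tensor_cmul_left)
next
  case (scale r X)
  have "cmul c (r *\<^sub>R X) = r *\<^sub>R cmul c X"
    by (rule linear_cmul[OF bounded_linear.linear[OF bounded_linear_cmul]])
  with scale show ?case by (simp add: min_tensor_scaleR)
next
  case closed
  have "closed (cmul c -` min_tensor A A)"
    by (intro continuous_closed_vimage closed_min_tensor linear_continuous_at bounded_linear_cmul)
  then show ?case by (simp add: vimage_def)
qed (auto simp: min_tensor_zero min_tensor_add)

lemma \<Delta>_in_min_tensor: "T \<in> A \<Longrightarrow> \<Delta> T \<in> min_tensor A A"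
proof (induction rule: A_induct)
  case (limit t T)
  then show ?case
    using closed_min_tensor closed_sequentially[OF closed_min_tensor _ tendsto_\<Delta>] by blast
qed (auto simp: \<Delta>_monomial \<Delta>_add \<Delta>_cmul min_tensor_add min_tensor_cmul op_tensor_in_min_tensor M_in_A)

lemma \<Delta>_clin: "T \<in> A \<Longrightarrow> clin (\<Delta> T)"
  using \<Delta>_in_min_tensor min_tensor_clin by blast

lemma \<Delta>_compose:
  assumes T: "T \<in> A" and R: "R \<in> A"
  shows "\<Delta> (T o\<^sub>L R) = \<Delta> T o\<^sub>L \<Delta> R"
proof -
  \<comment> \<open>One factor is approximated at a time: here \<open>R\<close> with a monomial on
    the left, afterwards the left factor with \<open>R\<close> fixed.\<close>
  have mono: "\<Delta> (V o\<^sub>L R) = \<Delta> V o\<^sub>L \<Delta> R" if V: "V \<in> M" for V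
    using R
  proof (induction rule: A_induct)
    case (monomial W)
    then show ?case
      using V by (simp add: \<Delta>_monomial monomials.intros op_tensor_compose monomial_clin)
  next
    case (add T R)
    then show ?case by (simp add: blinfun_compose_simps \<Delta>_add A_simps M_in_A[OF V])
  next
    case (scale c T)
    then show ?case by (simp add: \<Delta>_cmul A_simps \<Delta>_clin M_in_A[OF V])
  next
    case (limit t T)
    have "(\<lambda>n. \<Delta> (V o\<^sub>L t n)) \<longlonglongrightarrow> \<Delta> (V o\<^sub>L T)"
      by (intro tendsto_\<Delta> A_simps M_in_A V limit tendsto_intros)
    moreover have "(\<lambda>n. \<Delta> V o\<^sub>L \<Delta> (t n)) \<longlonglongrightarrow> (\<Delta> V o\<^sub>L \<Delta> T)"
      by (intro tendsto_\<Delta> limit tendsto_intros)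
    ultimately show ?case using limit.IH LIMSEQ_unique by simp
  qed
  show ?thesis
    using T
  proof (induction rule: A_induct)
    case (add T R)
    then show ?case by (simp add: blinfun_compose_simps \<Delta>_add A_simps R)
  next
    case (scale c T)
    then show ?case by (simp add: \<Delta>_cmul A_simps R)
  next
    case (limit t T)
    have "(\<lambda>n. \<Delta> (t n o\<^sub>L R)) \<longlonglongrightarrow> \<Delta> (T o\<^sub>L R)"
      by (intro tendsto_\<Delta> A_simps R limit tendsto_intros)
    moreover have "(\<lambda>n. \<Delta> (t n) o\<^sub>L \<Delta> R) \<longlonglongrightarrow> (\<Delta> T o\<^sub>L \<Delta> R)"
      by (intro tendsto_\<Delta> limit tendsto_intros)
    ultimately show ?case using limit.IH LIMSEQ_unique by simp
  qed (rule mono)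
qed

lemma \<Delta>_adj: "T \<in> A \<Longrightarrow> \<Delta> (adj T) = adj (\<Delta> T)"
proof (induction rule: A_induct)
  case (monomial V)
  then show ?case by (simp add: \<Delta>_monomial monomial_adj adj_op_tensor monomial_clin)
next
  case (limit t T)
  have "(\<lambda>n. \<Delta> (adj (t n))) \<longlonglongrightarrow> \<Delta> (adj T)"
    by (intro tendsto_\<Delta> tendsto_adj A_simps limit)
  moreover have "(\<lambda>n. adj (\<Delta> (t n))) \<longlonglongrightarrow> adj (\<Delta> T)"
    by (intro tendsto_\<Delta> tendsto_adj \<Delta>_clin limit)
  ultimately show ?case using limit.IH LIMSEQ_unique by simp
qed (simp_all add: adj_add adj_cmul A_simps \<Delta>_add \<Delta>_cmul \<Delta>_clin)

lemma star_hom_\<Delta>: "star_hom A (min_tensor A A) \<Delta>" "star_hom A {T. clin T} \<Delta>"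
  by (auto simp: star_hom_def clinear_map_on_def \<Delta>_in_min_tensor \<Delta>_clin \<Delta>_add \<Delta>_cmul \<Delta>_compose \<Delta>_adj)

sublocale continuous_star_hom S A \<Delta>
  by unfold_locales (rule cstar_A star_hom_\<Delta> \<Delta>_continuous)+

lemma compact_quantum_semigroup_A: "compact_quantum_semigroup S A \<Delta>"
  unfolding compact_quantum_semigroup_def
proof (intro conjI exI ballI allI)
  have proj: "proj S \<in> M" using monomials.intros(1)[OF zero] by (simp add: proj_eq_shift)
  show "cstar_subalgebra S A" "proj S \<in> A" "star_hom A (min_tensor A A) \<Delta>"
    by (rule cstar_A M_in_A proj star_hom_\<Delta>)+
  show "\<Delta> (proj S) = op_tensor (proj S) (proj S)" by (rule \<Delta>_monomial[OF proj])
  have sub: "A \<subseteq> {T. clin T}" using A_simps(1) by blast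
  show F: "is_tensor_map A A \<Delta> (\<lambda>T. T) amplify" by (rule is_tensor_map_amplify[OF sub])
  show G: "is_tensor_map A A (\<lambda>T. T) \<Delta> amplify_right" by (rule is_tensor_map_amplify_right[OF sub])
  fix T a b c a' b' c' assume "T \<in> A"
  then show "coord (amplify (\<Delta> T) (ket ((a, b), c))) ((a', b'), c') =
      coord (amplify_right (\<Delta> T) (ket (a, (b, c)))) (a', (b', c'))"
  proof (induction rule: A_induct)
    case (monomial V)
    have V: "V \<in> A" "clin V" using monomial by (auto intro: M_in_A monomial_clin)
    have "amplify (\<Delta> V) = op_tensor (op_tensor V V) V" "amplify_right (\<Delta> V) = op_tensor V (op_tensor V V)"
      using F G V(1) by (simp_all add: is_tensor_map_def \<Delta>_monomial[OF monomial])
    then show ?case using V(2) by simp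
  next
    case (add T R)
    then show ?case
      using F G by (simp add: is_tensor_map_def clinear_map_on_def \<Delta>_add \<Delta>_in_min_tensor blinfun.add_left)
  next
    case (scale c T)
    then show ?case
      using F G by (simp add: is_tensor_map_def clinear_map_on_def \<Delta>_cmul \<Delta>_in_min_tensor)
  next
    case (limit t T)
    \<comment> \<open>Polymorphic in the target space, because the two amplifications take values on
      differently bracketed triple products.\<close>
    have lim: "(\<lambda>n. coord (H (\<Delta> (t n)) v) p) \<longlonglongrightarrow> coord (H (\<Delta> T) v) p"
      if "continuous_on (min_tensor A A) H" for H :: "('g \<times> 'g) op \<Rightarrow> 'x op" and v p
    proof -
      have "(\<lambda>n. H (\<Delta> (t n))) \<longlonglongrightarrow> H (\<Delta> T)"
        by (rule continuous_on_tendsto_compose[OF that tendsto_\<Delta>]) (simp_all add: limit.hyps \<Delta>_in_min_tensor)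
      then show ?thesis
        by (intro bounded_linear.tendsto[OF bounded_linear_coord] blinfun.tendsto tendsto_const)
    qed
    have "continuous_on (min_tensor A A) amplify" "continuous_on (min_tensor A A) amplify_right"
      using F G by (simp_all add: is_tensor_map_def)
    from this[THEN lim]
    have "(\<lambda>n. coord (amplify (\<Delta> (t n)) (ket ((a, b), c))) ((a', b'), c'))
        \<longlonglongrightarrow> coord (amplify (\<Delta> T) (ket ((a, b), c))) ((a', b'), c')"
      and "(\<lambda>n. coord (amplify_right (\<Delta> (t n)) (ket (a, (b, c)))) (a', (b', c')))
        \<longlonglongrightarrow> coord (amplify_right (\<Delta> T) (ket (a, (b, c)))) (a', (b', c'))" by blast+
    then show ?case using limit.IH LIMSEQ_unique by simp
  qed
qed

text \<open>
  Distinct group-like elements are linearly independent: if \<open>W = \<Sum> \<mu> V * V\<close> with independent \<open>V\<close>, then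
  \<open>W \<otimes> W = \<Sum> \<mu> V * (V \<otimes> V)\<close>, and comparing matrix entries in the second factor gives \<open>V = W\<close>
  whenever \<open>\<mu> V \<noteq> 0\<close>.
\<close>

lemma monomials_independent:
  assumes "finite F" "F \<subseteq> M" "(\<Sum>V\<in>F. cmul (c V) V) = 0" "V \<in> F"
  shows "c V = 0"
  using assms
proof (induction F arbitrary: c V rule: finite_induct)
  case (insert W F)
  have F: "F \<subseteq> M" and W: "W \<in> M" using insert.prems(1) by auto
  have sum0: "cmul (c W) W + (\<Sum>V\<in>F. cmul (c V) V) = 0"
    using insert by simp
  have cW: "c W = 0"
  proof (rule ccontr)
    assume ne: "c W \<noteq> 0"
    define \<mu> where "\<mu> V = - c V / c W" for V
    have Weq: "W = (\<Sum>V\<in>F. cmul (\<mu> V) V)"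
    proof -
      have "W = cmul (1 / c W) (cmul (c W) W)" using ne by simp
      also have "cmul (c W) W = - (\<Sum>V\<in>F. cmul (c V) V)"
        using sum0 by (simp add: eq_neg_iff_add_eq_0)
      also have "\<dots> = cmul (- 1) (\<Sum>V\<in>F. cmul (c V) V)"
        using cmul_of_real[of "-1" "\<Sum>V\<in>F. cmul (c V) V"] by simp
      finally show ?thesis by (simp add: cmul_sum \<mu>_def)
    qed
    \<comment> \<open>Both sides are the value of \<open>\<Delta>\<close> at \<open>W\<close>,
      computed from \<open>W\<close> as a monomial and from \<open>W\<close> as a combination over
      \<open>F\<close>.\<close>
    have "op_tensor W W = (\<Sum>V\<in>F. cmul (\<mu> V) (op_tensor V V))"
      using \<Delta>_combinations[OF insert.hyps(1) F, of \<mu>] \<Delta>_monomial[OF W] by (simp flip: Weq)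
    then have bl: "block p q (op_tensor W W) = block p q (\<Sum>V\<in>F. cmul (\<mu> V) (op_tensor V V))" for p q
      by simp
    \<comment> \<open>Slicing leaves an entry of \<open>W\<close> times \<open>W\<close> on the
      left. Substituting the combination for that \<open>W\<close> produces a relation among
      elements of \<open>F\<close> alone, to which the induction hypothesis applies.\<close>
    have "(\<Sum>V\<in>F. cmul (\<mu> V * (coord (W (ket q)) p - coord (V (ket q)) p)) V) = 0" for p q
    proof -
      let ?w = "\<lambda>V. coord (V (ket q)) p"
      have "cmul (?w W) W = (\<Sum>V\<in>F. cmul (\<mu> V) (block p q (op_tensor V V)))"
        using bl[of p q] monomial_clin[OF W]
        by (simp add: block_op_tensor linear_sum[OF bounded_linear.linear[OF bounded_linear_block]] block_cmul)
      also have "\<dots> = (\<Sum>V\<in>F. cmul (\<mu> V * ?w V) V)"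
        using F by (intro sum.cong) (auto simp: block_op_tensor monomial_clin)
      also have "cmul (?w W) W = (\<Sum>V\<in>F. cmul (\<mu> V * ?w W) V)"
        by (subst (2) Weq) (simp add: cmul_sum mult.commute)
      finally have "(\<Sum>V\<in>F. cmul (\<mu> V * ?w W) V) - (\<Sum>V\<in>F. cmul (\<mu> V * ?w V) V) = 0" by simp
      moreover have "cmul (\<mu> V * (?w W - ?w V)) V = cmul (\<mu> V * ?w W) V - cmul (\<mu> V * ?w V) V" for V
        using cmul_add_left[of "\<mu> V * (?w W - ?w V)" "\<mu> V * ?w V" V]
        by (simp add: algebra_simps)
      ultimately show ?thesis by (simp add: sum_subtractf)
    qed
    from insert.IH[OF F this] have *: "\<mu> V * (coord (W (ket q)) p - coord (V (ket q)) p) = 0"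
      if "V \<in> F" for V p q using that by blast
    have "\<mu> V = 0" if V: "V \<in> F" for V
    proof (rule ccontr)
      assume "\<mu> V \<noteq> 0"
      then have "W = V"
        using *[OF V] F V by (intro clin_eqI monomial_clin W) auto
      then show False using V insert.hyps(2) by simp
    qed
    \<comment> \<open>With all coefficients zero the combination makes \<open>W\<close> zero, which
      no monomial is.\<close>
    then have "(\<Sum>V\<in>F. cmul (\<mu> V) V) = 0" by (intro sum.neutral) simp
    then show False using Weq monomial_nonzero[OF W] by simp
  qed
  show ?case
  proof (cases "V = W")
    case False
    then show ?thesis using insert.IH[OF F _ , of c V] insert.prems(3) sum0 cW by simp
  qed (simp add: cW)
qed simp

lemma realize_eq_0:
  assumes "x \<in> free_space M" "realize x = 0"
  shows "x = 0"
proof -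
  have "Poly_Mapping.lookup x V = 0" if "V \<in> Poly_Mapping.keys x" for V
    by (rule monomials_independent[OF _ _ _ that])
      (use assms in \<open>auto simp: free_space_def realize_def\<close>)
  then show ?thesis by (intro poly_mapping_eqI) (auto simp: in_keys_iff)
qed

text \<open>Independence is used once per factor. Slicing the second factor and independence in the
  first give, for each \<open>V\<close>, the vanishing of all entries of the combination of the
  \<open>W\<close> with coefficients at \<open>(V, W)\<close>; independence then kills the
  coefficients.\<close>

lemma realize2_eq_0:
  assumes t: "t \<in> free_space (M \<times> M)" and "realize2 t = 0"
  shows "t = 0"
proof -
  \<comment> \<open>The support is enlarged to a rectangle, with zero coefficients at the new pairs,
    so that the sum can be iterated.\<close>
  define F G where "F = fst ` Poly_Mapping.keys t" and "G = snd ` Poly_Mapping.keys t"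
  let ?l = "Poly_Mapping.lookup t"
  have FG: "finite F" "finite G" "F \<subseteq> M" "G \<subseteq> M" "Poly_Mapping.keys t \<subseteq> F \<times> G"
    using t by (force simp: F_def G_def free_space_def)+
  have t_eq: "realize2 t = (\<Sum>V\<in>F. \<Sum>W\<in>G. cmul (?l (V, W)) (op_tensor V W))"
    unfolding realize2_def sum.cartesian_product
    by (rule sum.mono_neutral_left) (use FG in \<open>auto simp: in_keys_iff\<close>)
  have slice0: "(\<Sum>W\<in>G. ?l (V, W) * coord (W (ket q)) p) = 0" if "V \<in> F" for V p q
  proof (rule monomials_independent[OF FG(1,3) _ that])
    have "0 = block p q (realize2 t)"
      using assms(2) by (simp add: linear_0[OF bounded_linear.linear[OF bounded_linear_block]])
    also have "\<dots> = (\<Sum>V\<in>F. \<Sum>W\<in>G. cmul (?l (V, W)) (block p q (op_tensor V W)))"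
      unfolding t_eq by (simp add: linear_sum[OF bounded_linear.linear[OF bounded_linear_block]] block_cmul)
    also have "\<dots> = (\<Sum>V\<in>F. \<Sum>W\<in>G. cmul (?l (V, W) * coord (W (ket q)) p) V)"
      using FG by (intro sum.cong refl) (auto simp: block_op_tensor monomial_clin subset_iff)
    also have "\<dots> = (\<Sum>V\<in>F. cmul (\<Sum>W\<in>G. ?l (V, W) * coord (W (ket q)) p) V)"
    proof (rule sum.cong[OF refl])
      fix V
      show "(\<Sum>W\<in>G. cmul (?l (V, W) * coord (W (ket q)) p) V) =
          cmul (\<Sum>W\<in>G. ?l (V, W) * coord (W (ket q)) p) V"
        by (induction G rule: infinite_finite_induct) (auto simp: cmul_add_left)
    qed
    finally show "(\<Sum>V\<in>F. cmul (\<Sum>W\<in>G. ?l (V, W) * coord (W (ket q)) p) V) = 0" by simp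
  qed
  have "?l (V, W) = 0" if V: "V \<in> F" and W: "W \<in> G" for V W
  proof (rule monomials_independent[OF FG(2,4) _ W])
    show "(\<Sum>W\<in>G. cmul (?l (V, W)) W) = 0"
    proof (rule clin_eqI)
      show "clin (\<Sum>W\<in>G. cmul (?l (V, W)) W)" using FG monomial_clin by (intro clin_sum) auto
    qed (auto simp: blinfun.sum_left slice0[OF V])
  qed
  then have "Poly_Mapping.lookup t p = 0" for p
    using FG(5) by (cases "p \<in> Poly_Mapping.keys t") (auto simp: in_keys_iff)
  then show ?thesis by (intro poly_mapping_eqI) simp
qed

lemma inj_realize: "inj_on realize (free_space M)" "inj_on realize2 (free_space (M \<times> M))"
proof -
  have neg: "cmul (- 1) T + T = 0" for T :: "'x op"
    using cmul_add_left[of "- 1" 1 T] by simp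
  \<comment> \<open>Differences are expressed by \<open>smul (- 1)\<close> and addition, the
    operations that both realizations are known to respect, so injectivity reduces to a trivial
    kernel.\<close>
  have eq: "x = y" if "smul (- 1) x + y = 0" for x y :: "'m \<Rightarrow>\<^sub>0 complex"
  proof (rule poly_mapping_eqI)
    fix k
    have "Poly_Mapping.lookup (smul (- 1) x + y) k = 0" by (simp add: that)
    then show "Poly_Mapping.lookup x k = Poly_Mapping.lookup y k" by (simp add: lookup_add)
  qed
  show "inj_on realize (free_space M)"
    by (rule inj_onI, rule eq, rule realize_eq_0) (auto simp: neg)
  show "inj_on realize2 (free_space (M \<times> M))"
    by (rule inj_onI, rule eq, rule realize2_eq_0) (auto simp: neg)
qed

lemma contains_dense_weak_hopf_algebra_A:
  "contains_dense_weak_hopf_algebra A \<Delta> M (sa_mult (o\<^sub>L)) sa_comult (sa_antipode adj)"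
  unfolding contains_dense_weak_hopf_algebra_def
  using weak_hopf_semigroup_algebra[OF monomials_inverse_semigroup]
    inj_realize realize_mult \<Delta>_realize A_simps(7) A_eq_closure
  by auto

end

theorem theorem9:
  fixes S :: "'g::ab_group_add set" and \<Delta> :: "'g op \<Rightarrow> ('g \<times> 'g) op"
  assumes torsion_free: "\<And>(x::'g) n. 0 < n \<Longrightarrow> (\<Sum>i<(n::nat). x) = 0 \<Longrightarrow> x = 0"
    and zero: "0 \<in> S"
    and add_closed: "\<And>a b. a \<in> S \<Longrightarrow> b \<in> S \<Longrightarrow> a + b \<in> S"
    and generates: "(UNIV :: 'g set) = {a - b | a b. a \<in> S \<and> b \<in> S}"
    and \<Delta>_continuous: "continuous_on (reduced_cstar S) \<Delta>"
    and \<Delta>_combinations: "\<And>(F :: 'g op set) (c :: 'g op \<Rightarrow> complex).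
      finite F \<Longrightarrow> F \<subseteq> monomials S \<Longrightarrow>
      \<Delta> (\<Sum>V\<in>F. cmul (c V) V) = (\<Sum>V\<in>F. cmul (c V) (op_tensor V V))"
  shows "compact_quantum_semigroup S (reduced_cstar S) \<Delta> \<and>
    inverse_semigroup (monomials S) (o\<^sub>L) adj \<and>
    contains_dense_weak_hopf_algebra (reduced_cstar S) \<Delta>
      (monomials S) (sa_mult (o\<^sub>L)) sa_comult (sa_antipode adj)"
proof -
  interpret comultiplication_on_monomials S \<Delta>
    by unfold_locales (fact zero add_closed \<Delta>_continuous \<Delta>_combinations)+
  show ?thesis
    using compact_quantum_semigroup_A monomials_inverse_semigroup
      contains_dense_weak_hopf_algebra_A by blast
qed

end
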